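(* Let $n\ge1$ be an integer and put $k=\lfloor \frac{n+1}{2}\rfloor$. For each permissible sequence $\varepsilon=(\varepsilon_1,\dots,\varepsilon_n)$ of length $n$ (see context), define polynomials $a_i(t_i)=a_{n+1-i}(t_i)\in\mathbb{Z}[t_i]$ for $1\le i\le k$ by $a_i(t_i)=2t_i+1$ if $\varepsilon_i=1$ and $a_i(t_i)=2t_i+2$ if $\varepsilon_i=0$. Let $P_i,Q_i\in\mathbb{Z}[t_1,\dots,t_k]$ be defined by $P_{-1}=1,Q_{-1}=0,P_0=0,Q_0=1$, $P_i=a_iP_{i-1}+P_{i-2}$, $Q_i=a_iQ_{i-1}+Q_{i-2}$ for $1\le i\le n$. Set $$a_0=a_0(t_0,t_1,\dots,t_k)=(-1)^{n}\frac{Q_{n-1}P_{n-1}}{2}+t_0Q_n,\qquad F_\varepsilon=a_0^2+2t_0P_n+(-1)^{n}P_{n-1}^2 .$$ Call a tuple $(t_0,t_1,\dots,t_k)$ admissible if $t_1,\dots,t_k$ are non-negative integers, $t_0\in\frac12\mathbb{Z}$ with $t_0Q_n(t_1,\dots,t_k)\in\mathbb{Z}$ (i.e. $t_0$ may be a half-integer exactly when $Q_n$ is even, and is an integer otherwise), and $t_0>(-1)^{n+1}\frac{Q_{n-1}P_{n-1}}{2Q_n}$. Then: (i) There are $r(n)$ such polynomials $F_\varepsilon$, each is a multi-variable Fermat–Pell polynomial, and every positive integer $D$ whose square root has a continued fraction expansion with period $n+1$ (i.e. $\sqrt D=[b_0;\overline{b_1,\dots,b_n,2b_0}]$ with least period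 $n+1$) equals $F_\varepsilon(t_0,\dots,t_k)$ for some admissible tuple for exactly one permissible sequence $\varepsilon$. (ii) For every admissible tuple, $a_0$ is a positive integer and $$\sqrt{F_\varepsilon}=[\,a_0;\overline{a_1(t_1),a_2(t_2),\dots,a_{n-1}(t_2),a_n(t_1),2a_0}\,].$$ (iii) With $C=a_0Q_n+P_n$ and $H=Q_n$ one has $C^2-F_\varepsilon H^2=(-1)^{n-1}$ identically, and for every admissible tuple, $(C,H)$ evaluated at it is the fundamental solution in integers of $X^2-F_\varepsilon Y^2=(-1)^{n-1}$ (i.e. $(C,H)$ is the fundamental polynomial solution).
   Context: A zero-one sequence $(\varepsilon_1,\dots,\varepsilon_n)$ is symmetric if $\varepsilon_i=\varepsilon_{n+1-i}$. It is called permissible if it is symmetric and $\begin{pmatrix}0&1\\1&0\end{pmatrix}\prod_{i=1}^n\begin{pmatrix}\varepsilon_i&1\\1&0\end{pmatrix}\not\equiv\begin{pmatrix}*&1\\ *&1\end{pmatrix}\pmod 2$, i.e. the right column of this product is not $\equiv(1,1)^T \pmod 2$. $r(n)$ denotes the number of permissible sequences of length $n$. A polynomial $F\in\mathbb{Z}[t_0,\dots,t_k]$ is a multi-variable Fermat–Pell polynomial if there are $C,H\in\mathbb{Z}[t_0,\dots,t_k]$ with $C^2-FH^2=1$ identically or $C^2-FH^2=-1$ identically. Notation: $[c_0;\overline{c_1,\dots,c_m}]$ denotes the periodic simple continued fraction $c_0+\frac{1}{c_1+}\frac{1}{c_2+}\cdots$ with period $c_1,\dots,c_m$. The fundamental solution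 of $X^2-DY^2=\pm1$ is the solution in positive integers with smallest $X+Y\sqrt D$.
   Formalization: In (iii), fundamentality of (C,H) is claimed only for admissible tuples whose expansion has no period p < n+1 with p ≡ n+1 (mod 2). Without this it fails: n=2, ε=(0,0), t_0=t_1=0 gives F=2, (C,H)=(7,5), but (1,1) is smaller. *)

theory Defs
  imports "HOL-Analysis.Analysis" "HOL-Library.Poly_Mapping" "HOL-Number_Theory.Cong"
begin

(* Polynomials in the variables t_0, t_1, ...: a finitely supported map from exponent vectors
   to coefficients, the product being the convolution product of Poly_Mapping.
   Coefficients are real because a_0 is written with a factor 1/2 and is evaluated at
   half-integers; \<int>[t_0,...,t_k] is the subring int_polys k. *)

type_synonym mpoly = "(nat \<Rightarrow>\<^sub>0 nat) \<Rightarrow>\<^sub>0 real"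

definition Cst :: "real \<Rightarrow> mpoly" where
  "Cst c = Poly_Mapping.single 0 c"

definition Var :: "nat \<Rightarrow> mpoly" where
  "Var i = Poly_Mapping.single (Poly_Mapping.single i 1) 1"

definition eval_at :: "(nat \<Rightarrow> real) \<Rightarrow> mpoly \<Rightarrow> real" where
  "eval_at t p = (\<Sum>m\<in>Poly_Mapping.keys p.
     Poly_Mapping.lookup p m * (\<Prod>i\<in>Poly_Mapping.keys m. t i ^ Poly_Mapping.lookup m i))"

definition int_polys :: "nat \<Rightarrow> mpoly set" where
  "int_polys k = {p. \<forall>m\<in>Poly_Mapping.keys p.
     Poly_Mapping.lookup p m \<in> \<int> \<and> Poly_Mapping.keys m \<subseteq> {0..k}}"

definition fermat_pell_poly :: "nat \<Rightarrow> mpoly \<Rightarrow> bool" where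
  "fermat_pell_poly k F \<longleftrightarrow> F \<in> int_polys k \<and>
     (\<exists>C\<in>int_polys k. \<exists>H\<in>int_polys k. C\<^sup>2 - F * H\<^sup>2 = 1 \<or> C\<^sup>2 - F * H\<^sup>2 = -1)"


(* Sequences (e_1,...,e_n) are lists; lists are indexed from 0. *)

definition entry :: "nat list \<Rightarrow> nat \<Rightarrow> nat" where
  "entry e i = e ! (i - 1)"

definition symmetric_seq :: "nat \<Rightarrow> nat list \<Rightarrow> bool" where
  "symmetric_seq n e \<longleftrightarrow> (\<forall>i\<in>{1..n}. entry e i = entry e (n + 1 - i))"

definition quotient_matrix :: "int \<Rightarrow> int^2^2" where
  "quotient_matrix x = vector [vector [x, 1], vector [1, 0]]"

definition permissible_matrix :: "nat list \<Rightarrow> int^2^2" where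
  "permissible_matrix e =
     vector [vector [0, 1], vector [1, 0]]
       ** foldr (\<lambda>x M. quotient_matrix (int x) ** M) e (mat 1)"

definition permissible :: "nat \<Rightarrow> nat list \<Rightarrow> bool" where
  "permissible n e \<longleftrightarrow> length e = n \<and> set e \<subseteq> {0, 1} \<and> symmetric_seq n e \<and>
     \<not> ([permissible_matrix e $ 1 $ 2 = 1] (mod 2) \<and> [permissible_matrix e $ 2 $ 2 = 1] (mod 2))"

definition r :: "nat \<Rightarrow> nat" where
  "r n = card {e. permissible n e}"


(* For 1 \<le> i \<le> n the index min i (n + 1 - i) is the one of i, n + 1 - i lying in {1..k},
   k = (n + 1) div 2; this encodes a_(n+1-i) = a_i. *)
definition a_poly :: "nat \<Rightarrow> nat list \<Rightarrow> nat \<Rightarrow> mpoly" where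
  "a_poly n e i = (let j = min i (n + 1 - i) in
     if entry e j = 1 then 2 * Var j + 1 else 2 * Var j + 2)"

(* The case Suc 0 uses P_(-1) = 1 and Q_(-1) = 0. *)

fun P_rec :: "(nat \<Rightarrow> 'a::comm_ring_1) \<Rightarrow> nat \<Rightarrow> 'a" where
  "P_rec a 0 = 0"
| "P_rec a (Suc 0) = a 1 * P_rec a 0 + 1"
| "P_rec a (Suc (Suc i)) = a (Suc (Suc i)) * P_rec a (Suc i) + P_rec a i"

fun Q_rec :: "(nat \<Rightarrow> 'a::comm_ring_1) \<Rightarrow> nat \<Rightarrow> 'a" where
  "Q_rec a 0 = 1"
| "Q_rec a (Suc 0) = a 1 * Q_rec a 0 + 0"
| "Q_rec a (Suc (Suc i)) = a (Suc (Suc i)) * Q_rec a (Suc i) + Q_rec a i"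

definition P_poly :: "nat \<Rightarrow> nat list \<Rightarrow> nat \<Rightarrow> mpoly" where
  "P_poly n e = P_rec (a_poly n e)"

definition Q_poly :: "nat \<Rightarrow> nat list \<Rightarrow> nat \<Rightarrow> mpoly" where
  "Q_poly n e = Q_rec (a_poly n e)"

definition a0_poly :: "nat \<Rightarrow> nat list \<Rightarrow> mpoly" where
  "a0_poly n e =
     Cst ((-1) ^ n / 2) * (Q_poly n e (n - 1) * P_poly n e (n - 1)) + Var 0 * Q_poly n e n"

definition F_poly :: "nat \<Rightarrow> nat list \<Rightarrow> mpoly" where
  "F_poly n e =
     (a0_poly n e)\<^sup>2 + 2 * Var 0 * P_poly n e n + (-1) ^ n * (P_poly n e (n - 1))\<^sup>2"

definition C_poly :: "nat \<Rightarrow> nat list \<Rightarrow> mpoly" where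
  "C_poly n e = a0_poly n e * Q_poly n e n + P_poly n e n"

definition H_poly :: "nat \<Rightarrow> nat list \<Rightarrow> mpoly" where
  "H_poly n e = Q_poly n e n"

(* A tuple (t_0,...,t_k) is a function on nat whose values beyond k play no role. *)
definition admissible :: "nat \<Rightarrow> nat list \<Rightarrow> (nat \<Rightarrow> real) \<Rightarrow> bool" where
  "admissible n e t \<longleftrightarrow>
     (\<forall>i\<in>{1..(n + 1) div 2}. t i \<in> \<nat>) \<and>
     2 * t 0 \<in> \<int> \<and> t 0 * eval_at t (Q_poly n e n) \<in> \<int> \<and>
     t 0 > (-1) ^ (n + 1) * (eval_at t (Q_poly n e (n - 1)) * eval_at t (P_poly n e (n - 1)))
             / (2 * eval_at t (Q_poly n e n))"


fun convergent_cf :: "(nat \<Rightarrow> real) \<Rightarrow> nat \<Rightarrow> real" where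
  "convergent_cf c 0 = c 0"
| "convergent_cf c (Suc m) = c 0 + 1 / convergent_cf (\<lambda>i. c (Suc i)) m"

definition simple_cf :: "(nat \<Rightarrow> real) \<Rightarrow> real \<Rightarrow> bool" where
  "simple_cf c x \<longleftrightarrow> (\<forall>i. c i \<in> \<int>) \<and> (\<forall>i\<ge>1. c i > 0) \<and> convergent_cf c \<longlonglongrightarrow> x"

definition periodic_seq :: "real \<Rightarrow> real list \<Rightarrow> nat \<Rightarrow> real" where
  "periodic_seq c0 cs i = (if i = 0 then c0 else cs ! ((i - 1) mod length cs))"

definition is_period :: "(nat \<Rightarrow> real) \<Rightarrow> nat \<Rightarrow> bool" where
  "is_period c p \<longleftrightarrow> p > 0 \<and> (\<forall>i\<ge>1. c (i + p) = c i)"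

definition least_period :: "(nat \<Rightarrow> real) \<Rightarrow> nat \<Rightarrow> bool" where
  "least_period c p \<longleftrightarrow> is_period c p \<and> (\<forall>q. is_period c q \<longrightarrow> p \<le> q)"

definition sqrt_has_period :: "nat \<Rightarrow> nat \<Rightarrow> bool" where
  "sqrt_has_period D n \<longleftrightarrow>
     (\<exists>b0 bs. length bs = n \<and>
        simple_cf (periodic_seq b0 (bs @ [2 * b0])) (sqrt (real D)) \<and>
        least_period (periodic_seq b0 (bs @ [2 * b0])) (n + 1))"

definition expansion_seq :: "nat \<Rightarrow> nat list \<Rightarrow> (nat \<Rightarrow> real) \<Rightarrow> nat \<Rightarrow> real" where
  "expansion_seq n e t =
     periodic_seq (eval_at t (a0_poly n e))
       (map (\<lambda>i. eval_at t (a_poly n e i)) [1..<n + 1] @ [2 * eval_at t (a0_poly n e)])"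

definition pell_solution :: "real \<Rightarrow> real \<Rightarrow> real \<Rightarrow> real \<Rightarrow> bool" where
  "pell_solution D s x y \<longleftrightarrow> x \<in> \<int> \<and> y \<in> \<int> \<and> x > 0 \<and> y > 0 \<and> x\<^sup>2 - D * y\<^sup>2 = s"

definition fundamental_solution :: "real \<Rightarrow> real \<Rightarrow> real \<Rightarrow> real \<Rightarrow> bool" where
  "fundamental_solution D s x y \<longleftrightarrow> pell_solution D s x y \<and>
     (\<forall>x' y'. pell_solution D s x' y' \<longrightarrow> x + y * sqrt D \<le> x' + y' * sqrt D)"

(* An admissible tuple may give an expansion whose least period is a proper divisor of n + 1.
   A period p < n + 1 with p \<equiv> n + 1 (mod 2) yields a solution of X^2 - F Y^2 = (-1)^(n-1)
   smaller than (C, H): for n = 2, e = (0,0), t = (0,0) one has F = 2 and (C, H) = (7, 5),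
   whereas (1, 1) solves X^2 - 2 Y^2 = -1. Exactly these tuples must be excluded when (C, H)
   is claimed to be fundamental; a shorter period of the other parity does no harm. *)
definition no_shorter_period_same_parity :: "(nat \<Rightarrow> real) \<Rightarrow> nat \<Rightarrow> bool" where
  "no_shorter_period_same_parity c m \<longleftrightarrow>
     (\<forall>p. is_period c p \<and> even p = even m \<longrightarrow> m \<le> p)"

end

theory Submission
  imports Defs
begin

text \<open>
  Write \<open>M\<close> for the product of the matrices \<open>((x, 1), (1, 0))\<close> over the partial quotients
  \<open>a\<^sub>1, \<dots>, a\<^sub>n\<close>; its columns are \<open>(Q\<^sub>n, P\<^sub>n)\<close> and \<open>(Q\<^sub>n\<^sub>-\<^sub>1, P\<^sub>n\<^sub>-\<^sub>1)\<close>. The equation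
  \<open>\<surd>D = [b\<^sub>0; a\<^sub>1, \<dots>, a\<^sub>n, b\<^sub>0 + \<surd>D]\<close> is quadratic in \<open>\<surd>D\<close>; as \<open>\<surd>D\<close> is irrational, it says that \<open>M\<close>
  is symmetric, so that the \<open>a\<^sub>i\<close> form a palindrome, and that \<open>Q\<^sub>n (D - b\<^sub>0\<^sup>2) = 2 P\<^sub>n b\<^sub>0 + P\<^sub>n\<^sub>-\<^sub>1\<close>.
  Since \<open>det M = (-1)\<^sup>n\<close>, the integral solutions \<open>(b\<^sub>0, D)\<close> of the latter are exactly the values
  of \<open>(a\<^sub>0, F)\<close>, and the parity of \<open>M\<close>, which depends only on the parities of the \<open>a\<^sub>i\<close>, decides
  whether there are any. Conversely a solution \<open>(x, y)\<close> of \<open>x\<^sup>2 - D y\<^sup>2 = \<plusminus>1\<close> yields a symmetric matrix with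
  first column \<open>(y, x - b\<^sub>0 y)\<close> that factors into such a product, hence a period of \<open>\<surd>D\<close>; as \<open>Q\<close>
  increases along the expansion, the shortest period gives the fundamental solution.
\<close>

section \<open>Continued fractions\<close>

definition cf_value :: "real list \<Rightarrow> real \<Rightarrow> real" where
  "cf_value xs z = foldr (\<lambda>a w. a + 1 / w) xs z"

lemma cf_value_simps [simp]:
  "cf_value [] z = z"
  "cf_value (x # xs) z = x + 1 / cf_value xs z"
  by (simp_all add: cf_value_def)

lemma cf_value_append: "cf_value (xs @ ys) z = cf_value xs (cf_value ys z)"
  by (simp add: cf_value_def)

text \<open>The entries are continuants. The ring is left arbitrary because integer, real and
  polynomial partial quotients all occur.\<close>

definition cf_matrix :: "'a::comm_ring_1 list \<Rightarrow> 'a^2^2" where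
  "cf_matrix xs = foldr (\<lambda>x M. vector [vector [x, 1], vector [1, 0]] ** M) xs (mat 1)"

lemma cf_matrix_Nil [simp]:
  "cf_matrix [] $ 1 $ 1 = 1" "cf_matrix [] $ 1 $ 2 = 0"
  "cf_matrix [] $ 2 $ 1 = 0" "cf_matrix [] $ 2 $ 2 = 1"
  by (simp_all add: cf_matrix_def mat_def)

lemma cf_matrix_Cons [simp]:
  "cf_matrix (x # xs) $ 1 $ j = x * cf_matrix xs $ 1 $ j + cf_matrix xs $ 2 $ j"
  "cf_matrix (x # xs) $ 2 $ j = cf_matrix xs $ 1 $ j"
  by (simp_all add: cf_matrix_def matrix_matrix_mult_def sum_2)

lemma cf_matrix_snoc:
  "cf_matrix (xs @ [x]) $ i $ 1 = x * cf_matrix xs $ i $ 1 + cf_matrix xs $ i $ 2"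
  "cf_matrix (xs @ [x]) $ i $ 2 = cf_matrix xs $ i $ 1"
proof (induction xs arbitrary: i)
  case Nil
  { case 1 show ?case using exhaust_2[of i] by auto }
  { case 2 show ?case using exhaust_2[of i] by auto }
next
  case (Cons y xs)
  { case 1 show ?case using exhaust_2[of i] by (auto simp: Cons algebra_simps) }
  { case 2 show ?case using exhaust_2[of i] by (auto simp: Cons algebra_simps) }
qed

lemma cf_matrix_det:
  "cf_matrix xs $ 1 $ 1 * cf_matrix xs $ 2 $ 2 - cf_matrix xs $ 1 $ 2 * cf_matrix xs $ 2 $ 1
     = (-1) ^ length xs"
proof (induction xs)
  case (Cons x xs)
  show ?case using Cons[symmetric] by (simp add: algebra_simps)
qed simp

text \<open>Each factor is a symmetric matrix, so transposing the product reverses the order of the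
  factors.\<close>

lemma cf_matrix_rev: "cf_matrix (rev xs) $ i $ j = cf_matrix xs $ j $ i"
proof (induction xs arbitrary: i j)
  case Nil
  show ?case using exhaust_2[of i] exhaust_2[of j] by auto
next
  case (Cons x xs)
  show ?case using exhaust_2[of j] by (auto simp: cf_matrix_snoc Cons)
qed

lemma cf_matrix_of_int:
  "cf_matrix (map of_int xs) $ i $ j = of_int (cf_matrix xs $ i $ j)"
proof (induction xs arbitrary: i j)
  case Nil
  show ?case using exhaust_2[of i] exhaust_2[of j] by auto
next
  case (Cons x xs)
  show ?case using exhaust_2[of i] by (auto simp: Cons)
qed

lemma cf_matrix_rec:
  fixes a :: "nat \<Rightarrow> 'a::comm_ring_1"
  shows "cf_matrix (map a [1..<n + 1]) $ 1 $ 1 = Q_rec a n"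
    "cf_matrix (map a [1..<n + 1]) $ 2 $ 1 = P_rec a n"
    "n \<ge> 1 \<Longrightarrow> cf_matrix (map a [1..<n + 1]) $ 1 $ 2 = Q_rec a (n - 1)"
    "n \<ge> 1 \<Longrightarrow> cf_matrix (map a [1..<n + 1]) $ 2 $ 2 = P_rec a (n - 1)"
proof -
  have snoc: "map a [1..<Suc n + 1] = map a [1..<n + 1] @ [a (Suc n)]" for n
    by simp
  \<comment> \<open>At length 0 the second column would have index -1, which recursions on the
    naturals cannot express; the induction therefore starts at length 1.\<close>
  have Suc: "cf_matrix (map a [1..<Suc n + 1]) $ 1 $ 1 = Q_rec a (Suc n) \<and>
    cf_matrix (map a [1..<Suc n + 1]) $ 2 $ 1 = P_rec a (Suc n) \<and>
    cf_matrix (map a [1..<Suc n + 1]) $ 1 $ 2 = Q_rec a n \<and>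
    cf_matrix (map a [1..<Suc n + 1]) $ 2 $ 2 = P_rec a n" for n
  proof (induction n)
    case 0
    show ?case by simp
  next
    case (Suc n)
    then show ?case unfolding snoc[of "Suc n"] cf_matrix_snoc by simp
  qed
  show "cf_matrix (map a [1..<n + 1]) $ 1 $ 1 = Q_rec a n"
    "cf_matrix (map a [1..<n + 1]) $ 2 $ 1 = P_rec a n"
    "n \<ge> 1 \<Longrightarrow> cf_matrix (map a [1..<n + 1]) $ 1 $ 2 = Q_rec a (n - 1)"
    "n \<ge> 1 \<Longrightarrow> cf_matrix (map a [1..<n + 1]) $ 2 $ 2 = P_rec a (n - 1)"
    using Suc[of "n - 1"] by (cases n; simp)+
qed

text \<open>The matrix acts on \<open>z\<close> as a Moebius transformation. Positivity is proved
  along with the formula because the induction step needs nonzero denominators.\<close>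

lemma cf_value_matrix:
  assumes "\<forall>a\<in>set xs. a > 0" "z > 0"
  defines "M \<equiv> cf_matrix xs"
  shows "M $ 1 $ 1 * z + M $ 1 $ 2 > 0" "M $ 2 $ 1 * z + M $ 2 $ 2 > 0"
    "cf_value xs z = (M $ 1 $ 1 * z + M $ 1 $ 2) / (M $ 2 $ 1 * z + M $ 2 $ 2)"
proof -
  have "cf_matrix xs $ 1 $ 1 * z + cf_matrix xs $ 1 $ 2 > 0 \<and>
    cf_matrix xs $ 2 $ 1 * z + cf_matrix xs $ 2 $ 2 > 0 \<and>
    cf_value xs z = (cf_matrix xs $ 1 $ 1 * z + cf_matrix xs $ 1 $ 2) /
      (cf_matrix xs $ 2 $ 1 * z + cf_matrix xs $ 2 $ 2)"
    using assms(1)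
  proof (induction xs)
    case (Cons x xs)
    define N where "N = cf_matrix xs $ 1 $ 1 * z + cf_matrix xs $ 1 $ 2"
    define D where "D = cf_matrix xs $ 2 $ 1 * z + cf_matrix xs $ 2 $ 2"
    have pos: "N > 0" "D > 0" "x > 0" and val: "cf_value xs z = N / D"
      using Cons by (auto simp: N_def D_def)
    have "x * N + D > 0" using pos by (simp add: add_pos_pos)
    moreover have "cf_value (x # xs) z = (x * N + D) / N"
      using pos by (simp add: val add_divide_distrib)
    moreover have M: "cf_matrix (x # xs) $ 1 $ 1 * z + cf_matrix (x # xs) $ 1 $ 2 = x * N + D"
      "cf_matrix (x # xs) $ 2 $ 1 * z + cf_matrix (x # xs) $ 2 $ 2 = N"
      by (simp_all add: N_def D_def algebra_simps)
    ultimately show ?case unfolding M using pos(1) by blast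
  qed (use assms in auto)
  then show "M $ 1 $ 1 * z + M $ 1 $ 2 > 0" "M $ 2 $ 1 * z + M $ 2 $ 2 > 0"
    "cf_value xs z = (M $ 1 $ 1 * z + M $ 1 $ 2) / (M $ 2 $ 1 * z + M $ 2 $ 2)"
    by (auto simp: M_def)
qed

lemma cf_value_gt_1:
  assumes "\<forall>a\<in>set xs. a \<ge> 1" "z > 1"
  shows "cf_value xs z > 1"
  using assms
proof (induction xs)
  case (Cons x xs)
  then have "cf_value xs z > 1" "x \<ge> 1" by auto
  moreover from this have "1 / cf_value xs z > 0" by simp
  ultimately show ?case unfolding cf_value_simps by linarith
qed simp

text \<open>As \<open>1 / w\<close> and \<open>1 / v\<close> lie strictly between 0 and 1, both
  integers are the floor of the common value.\<close>

lemma int_add_inverse_inject: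
  fixes x y w v :: real
  assumes "x + 1 / w = y + 1 / v" "x \<in> \<int>" "y \<in> \<int>" "w > 1" "v > 1"
  shows "x = y \<and> w = v"
proof -
  have floor: "\<lfloor>k + 1 / u\<rfloor> = k" if "u > 1" for k :: int and u :: real
    using that by (intro floor_unique) auto
  obtain k l :: int where kl: "x = k" "y = l" using assms(2,3) by (auto elim!: Ints_cases)
  then have "k = l" using floor[OF assms(4), of k] floor[OF assms(5), of l] assms(1) unfolding kl by metis
  with kl assms(1,4,5) show ?thesis by simp
qed

text \<open>Requiring tails greater than 1 rules out the ambiguity
  \<open>[..., a, 1] = [..., a + 1]\<close> of finite expansions.\<close>

lemma cf_value_inject:
  assumes "length xs = length ys" "cf_value xs z = cf_value ys z'" "z > 1" "z' > 1"
    "\<forall>a\<in>set xs. a \<in> \<int> \<and> a \<ge> 1" "\<forall>a\<in>set ys. a \<in> \<int> \<and> a \<ge> 1"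
  shows "xs = ys"
  using assms
proof (induction xs ys rule: list_induct2)
  case (Cons x xs y ys)
  have "x = y \<and> cf_value xs z = cf_value ys z'"
    using Cons.prems by (intro int_add_inverse_inject) (auto intro: cf_value_gt_1)
  with Cons show ?case by auto
qed simp

section \<open>Infinite expansions: complete quotients, uniqueness and irrationality\<close>

lemma convergent_cf_ge_1:
  assumes "\<forall>i. c i \<ge> 1"
  shows "convergent_cf c m \<ge> 1"
  using assms
proof (induction m arbitrary: c)
  case (Suc m)
  have "convergent_cf (\<lambda>i. c (Suc i)) m \<ge> 1" "c 0 \<ge> 1" using Suc by auto
  then show ?case by (simp add: add_increasing2)
qed auto

lemma simple_cf_ge_1:
  assumes "simple_cf c x" "i \<ge> 1"
  shows "c i \<ge> 1"
proof -
  from assms have "c i \<in> \<int>" "c i > 0" by (auto simp: simple_cf_def)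
  then show ?thesis by (auto elim!: Ints_cases)
qed

text \<open>Since \<open>simple_cf\<close> speaks only of the limit of the whole sequence, the
  existence of the limit \<open>y\<close> of the shifted convergents has to be extracted from
  it.\<close>

lemma simple_cf_step:
  assumes "simple_cf c x"
  obtains y where "simple_cf (\<lambda>i. c (Suc i)) y" "x = c 0 + 1 / y" "y > 1"
proof -
  define d where "d = (\<lambda>i. c (Suc i))"
  have d1: "\<forall>i. d i \<ge> 1" using simple_cf_ge_1[OF assms] by (auto simp: d_def)
  define f where "f = convergent_cf d"
  have f1: "f m \<ge> 1" for m unfolding f_def by (rule convergent_cf_ge_1[OF d1])
  have fS: "f (Suc m) = d 0 + 1 / convergent_cf (\<lambda>i. d (Suc i)) m" for m
    by (simp add: f_def)
  have g1: "convergent_cf (\<lambda>i. d (Suc i)) m \<ge> 1" for m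
    by (rule convergent_cf_ge_1) (use d1 in auto)
  have fu: "f (Suc m) \<le> d 0 + 1" for m
    using le_imp_inverse_le[OF g1[of m]] by (simp add: fS inverse_eq_divide)
  have lim: "convergent_cf c \<longlonglongrightarrow> x" using assms by (auto simp: simple_cf_def)
  then have lim1: "(\<lambda>m. c 0 + 1 / f m) \<longlonglongrightarrow> x"
    using LIMSEQ_Suc[OF lim] by (simp add: f_def d_def)
  have lim2: "(\<lambda>m. 1 / f m) \<longlonglongrightarrow> x - c 0"
    using tendsto_diff[OF lim1 tendsto_const[of "c 0"]] by simp
  \<comment> \<open>The shifted convergents are bounded above, so their reciprocals stay away from 0
    and the limit may be inverted.\<close>
  have pos: "x - c 0 \<ge> 1 / (d 0 + 1)"
  proof (rule LIMSEQ_le_const[OF LIMSEQ_Suc[OF lim2]], intro exI allI impI)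
    fix m
    show "1 / (d 0 + 1) \<le> 1 / f (Suc m)"
      using fu[of m] f1[of "Suc m"] by (intro divide_left_mono) auto
  qed
  have "d 0 \<ge> 1" using d1 by auto
  then have pos': "x - c 0 > 0" using pos by (smt (verit) divide_pos_pos)
  define y where "y = 1 / (x - c 0)"
  have limf: "f \<longlonglongrightarrow> y"
    using tendsto_divide[OF tendsto_const[of 1] lim2] pos' by (simp add: y_def)
  \<comment> \<open>The bound 1 on every convergent yields only \<open>y \<ge> 1\<close> in the
    limit; the strict inequality needs a uniform bound obtained one level further down.\<close>
  have "y \<ge> d 0 + 1 / (d 1 + 1)"
  proof (rule LIMSEQ_le_const[OF LIMSEQ_Suc[OF LIMSEQ_Suc[OF limf]]], intro exI allI impI)
    fix m
    have h1: "convergent_cf (\<lambda>i. d (Suc (Suc i))) m \<ge> 1"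
      by (rule convergent_cf_ge_1) (use d1 in auto)
    then have "convergent_cf (\<lambda>i. d (Suc i)) (Suc m) \<le> d 1 + 1"
      using le_imp_inverse_le[OF h1] by (simp add: inverse_eq_divide)
    then show "d 0 + 1 / (d 1 + 1) \<le> f (Suc (Suc m))"
      unfolding fS using g1[of "Suc m"] by (intro add_left_mono divide_left_mono) auto
  qed
  moreover have "1 / (d 1 + 1) > 0" using d1[rule_format, of 1] by simp
  ultimately have y1: "y > 1" using d1[rule_format, of 0] by linarith
  have "simple_cf d y"
    using assms limf by (auto simp: simple_cf_def d_def f_def)
  moreover have "x = c 0 + 1 / y" using pos' by (simp add: y_def)
  ultimately show ?thesis using y1 that unfolding d_def by blast
qed

lemma simple_cf_unique:
  assumes "simple_cf c x" "simple_cf d x"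
  shows "c = d"
proof
  fix i
  show "c i = d i" using assms
  proof (induction i arbitrary: c d x)
    case 0
    obtain y where y: "x = c 0 + 1 / y" "y > 1" by (rule simple_cf_step[OF 0(1)])
    obtain z where z: "x = d 0 + 1 / z" "z > 1" by (rule simple_cf_step[OF 0(2)])
    show ?case
      using int_add_inverse_inject[of "c 0" y "d 0" z] y z 0 by (auto simp: simple_cf_def)
  next
    case (Suc i)
    obtain y where y: "simple_cf (\<lambda>i. c (Suc i)) y" "x = c 0 + 1 / y" "y > 1"
      by (rule simple_cf_step[OF Suc.prems(1)])
    obtain z where z: "simple_cf (\<lambda>i. d (Suc i)) z" "x = d 0 + 1 / z" "z > 1"
      by (rule simple_cf_step[OF Suc.prems(2)])
    have "y = z"
      using int_add_inverse_inject[of "c 0" y "d 0" z] y z Suc.prems by (auto simp: simple_cf_def)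
    then show ?case using Suc.IH[of "\<lambda>i. c (Suc i)" y "\<lambda>i. d (Suc i)"] y z by simp
  qed
qed

text \<open>Each step of the expansion replaces a fraction by one with a smaller denominator.\<close>

lemma simple_cf_irrational:
  assumes "simple_cf c x"
  shows "x \<notin> \<rat>"
proof
  assume "x \<in> \<rat>"
  then obtain p q :: int where "q > 0" "x = p / q" by (elim Rats_cases') auto
  then show False using assms
  proof (induction "nat q" arbitrary: q p x c rule: less_induct)
    case less
    obtain y where y: "simple_cf (\<lambda>i. c (Suc i)) y" "x = c 0 + 1 / y" "y > 1"
      by (rule simple_cf_step[OF less.prems(3)])
    obtain k where k: "c 0 = of_int k"
      using less.prems(3) by (metis simple_cf_def Ints_cases)
    define s where "s = p - k * q"
    have s: "real_of_int s = q / y"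
      using y less.prems k by (simp add: s_def field_simps)
    have q: "real_of_int q > 0" using less.prems by simp
    have "real_of_int s > 0" "real_of_int s < q"
      using y(3) q by (simp_all add: s field_simps)
    then have s': "0 < s" "s < q" by linarith+
    have "y = q / s" unfolding s using y(3) q by simp
    with less.hyps[OF _ s'(1) _ y(1)] s' show False by simp
  qed
qed

lemma all_Suc2: "\<forall>i. P i \<Longrightarrow> \<forall>i. P (Suc (Suc i))"
  by blast

text \<open>Two consecutive steps contract the distance to the limit by the factor 4.\<close>

lemma convergent_cf_error:
  assumes "\<forall>i. z i = c i + 1 / z (Suc i)" "\<forall>i. c (Suc i) \<ge> 1" "\<forall>i. z (Suc i) > 1"
  shows "\<bar>convergent_cf c m - z 0\<bar> \<le> (1 / 4) ^ (m div 2)"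
  using assms
proof (induction m arbitrary: c z rule: induct_nat_012)
  case 0
  have "1 / z (Suc 0) < 1" "1 / z (Suc 0) > 0"
    using 0(3)[rule_format, of 0] by (auto simp: divide_simps)
  with 0(1)[rule_format, of 0] show ?case by simp
next
  case 1
  define u where "u = z (Suc 0)"
  have u: "u > 1" "u \<ge> c 1" "c 1 \<ge> 1"
    using 1(1)[rule_format, of 1] 1(2)[rule_format, of 0] 1(3)[rule_format, of 0]
      1(3)[rule_format, of 1] by (auto simp: u_def)
  have "1 / u > 0" "1 / u \<le> 1" "1 / c 1 \<le> 1" "1 / c 1 > 0"
    using u by (auto simp: divide_simps)
  then have "\<bar>1 / c 1 - 1 / u\<bar> \<le> 1" by linarith
  then show ?case using 1(1)[rule_format, of 0] by (simp add: u_def[symmetric])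
next
  case (ge2 m)
  define f where "f = convergent_cf (\<lambda>i. c (Suc (Suc i))) m"
  define g where "g = c 1 + 1 / f"
  have f: "f \<ge> 1" unfolding f_def by (rule convergent_cf_ge_1) (use ge2.prems(2) in auto)
  have c1: "c 1 \<ge> 1" using ge2.prems(2)[rule_format, of 0] by simp
  have z: "z 0 = c 0 + 1 / z 1" "z 1 = c 1 + 1 / z 2" "z 1 > 1" "z 2 > 1"
    using ge2.prems(1)[rule_format, of 0] ge2.prems(1)[rule_format, of 1]
      ge2.prems(3)[rule_format, of 0] ge2.prems(3)[rule_format, of 1]
    by (simp_all add: numeral_2_eq_2)
  have IH: "\<bar>f - z 2\<bar> \<le> (1 / 4) ^ (m div 2)"
    unfolding f_def
    using ge2.IH(1)[of "\<lambda>i. z (Suc (Suc i))" "\<lambda>i. c (Suc (Suc i))",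
        OF ge2.prems(1)[THEN all_Suc2] ge2.prems(2,3)[THEN all_Suc2]]
    by (simp add: numeral_2_eq_2)
  have g: "g > 0" using f c1 by (simp add: g_def add_pos_nonneg)
  \<comment> \<open>Here \<open>g * f = c 1 * f + 1 \<ge> 2\<close>, and likewise
    \<open>z 1 * z 2 \<ge> 2\<close>; together they give the factor 4.\<close>
  have "c 1 * f \<ge> 1" "c 1 * z 2 \<ge> 1"
    using mult_mono[of 1 "c 1" 1 f] mult_mono[of 1 "c 1" 1 "z 2"] c1 f z(4) by auto
  moreover have gf': "g * f = c 1 * f + 1" using f by (simp add: g_def distrib_right)
  moreover have zz': "z 1 * z 2 = c 1 * z 2 + 1"
    using z(4) unfolding z(2) by (simp add: distrib_right)
  ultimately have gf: "g * f \<ge> 2" and zz: "z 1 * z 2 \<ge> 2" by auto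
  have "convergent_cf c (Suc (Suc m)) - z 0 = 1 / g - 1 / z 1"
    unfolding z(1) by (simp add: f_def g_def)
  also have "\<dots> = (z 1 - g) / (g * z 1)"
    using g z(3) by (simp add: divide_simps)
  also have "z 1 - g = 1 / z 2 - 1 / f" unfolding g_def using z(2) by linarith
  also have "\<dots> = (f - z 2) / (z 2 * f)"
    using f z(4) by (simp add: divide_simps)
  also have "\<dots> / (g * z 1) = (f - z 2) / ((g * f) * (z 1 * z 2))"
    by (simp add: mult_ac)
  finally have eq: "convergent_cf c (Suc (Suc m)) - z 0 = (f - z 2) / ((g * f) * (z 1 * z 2))" .
  have "0 < (g * f) * (z 1 * z 2)" using gf zz by (intro mult_pos_pos[of "g * f"]) linarith+
  then have "\<bar>convergent_cf c (Suc (Suc m)) - z 0\<bar> = \<bar>f - z 2\<bar> / ((g * f) * (z 1 * z 2))"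
    unfolding eq abs_divide by (simp only: abs_of_pos)
  also have "\<dots> \<le> \<bar>f - z 2\<bar> / 4"
    using mult_mono[OF gf zz] gf by (intro divide_left_mono) auto
  also have "\<dots> \<le> (1 / 4) ^ (Suc (Suc m) div 2)" using IH by simp
  finally show ?case .
qed

text \<open>Converse of iterating \<open>simple_cf_step\<close>: an expansion is recognised by
  exhibiting complete quotients greater than 1, without a separate convergence argument.\<close>

lemma simple_cf_complete_quotients:
  assumes "\<forall>i. z i = c i + 1 / z (Suc i)" "\<forall>i. c i \<in> \<int>"
    "\<forall>i. c (Suc i) \<ge> 1" "\<forall>i. z (Suc i) > 1"
  shows "simple_cf c (z 0)"
proof -
  have "(\<lambda>m. (1 / 4 :: real) ^ (m div 2)) \<longlonglongrightarrow> 0"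
  proof (rule filterlim_compose[OF LIMSEQ_realpow_zero])
    show "filterlim (\<lambda>m::nat. m div 2) at_top sequentially"
      by (rule filterlim_at_top_div_const_nat) simp
  qed auto
  then have "(\<lambda>m. convergent_cf c m - z 0) \<longlonglongrightarrow> 0"
    by (rule Lim_null_comparison[rotated])
      (use convergent_cf_error[OF assms(1,3,4)] in \<open>auto intro!: always_eventually\<close>)
  then have "convergent_cf c \<longlonglongrightarrow> z 0" by (rule LIM_zero_cancel)
  moreover have "c i > 0" if "i \<ge> 1" for i
    using assms(3)[rule_format, of "i - 1"] that by simp
  ultimately show ?thesis using assms(2) by (auto simp: simple_cf_def)
qed

section \<open>Periodic expansions and the Pell equation\<close>

lemma simple_cf_periodic_seq:
  assumes "b0 \<in> \<int>" "b0 > 0" "\<forall>a\<in>set bs. a \<in> \<int> \<and> a \<ge> 1" "x > 0"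
    and x: "x = b0 + 1 / cf_value bs (x + b0)"
  shows "simple_cf (periodic_seq b0 (bs @ [2 * b0])) x"
proof -
  define ys where "ys = bs @ [2 * b0]"
  define L where "L = length ys"
  define y where "y = cf_value bs (x + b0)"
  \<comment> \<open>The complete quotients: \<open>x\<close> itself, then the tails of one period
    closed with \<open>y\<close>.\<close>
  define z where "z i = (if i = 0 then x else cf_value (drop ((i - 1) mod L) ys) y)" for i
  have L: "L > 0" by (simp add: L_def ys_def)
  have b0: "b0 \<ge> 1" using assms(1,2) by (auto elim!: Ints_cases)
  have y1: "y > 1" unfolding y_def using assms(3,4) b0 by (intro cf_value_gt_1) auto
  have xy: "x = b0 + 1 / y" unfolding y_def by (rule x)
  \<comment> \<open>Since \<open>x = b0 + 1 / y\<close>, the last quotient \<open>2 * b0\<close>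
    turns \<open>y\<close> into \<open>x + b0\<close>; hence \<open>y\<close> is fixed by one full
    period.\<close>
  have "cf_value ys y = cf_value bs (2 * b0 + 1 / y)" by (simp add: ys_def cf_value_append)
  also have "2 * b0 + 1 / y = x + b0" using xy by linarith
  finally have yy: "cf_value ys y = y" by (simp only: y_def)
  have ys: "a \<in> \<int> \<and> a \<ge> 1" if "a \<in> set ys" for a
    using that assms(1,3) b0 by (auto simp: ys_def)
  have nth: "ys ! (j mod L) \<in> \<int> \<and> ys ! (j mod L) \<ge> 1" for j
    using L by (intro ys nth_mem) (simp add: L_def)
  have "z i = periodic_seq b0 ys i + 1 / z (Suc i)" for i
  proof (cases i)
    case 0
    then show ?thesis using xy by (simp add: z_def periodic_seq_def yy)
  next
    case (Suc j)
    define k where "k = j mod L"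
    have k: "k < length ys" using L by (simp add: k_def L_def)
    \<comment> \<open>At the end of a period the remaining tail is empty and has value
      \<open>y\<close>, which by \<open>yy\<close> is also the value of a whole period.\<close>
    have "z (Suc i) = cf_value (drop (Suc k) ys) y"
      using yy by (auto simp: z_def Suc mod_Suc k_def L_def)
    moreover have "z i = cf_value (drop k ys) y" by (simp add: z_def Suc k_def)
    moreover have "drop k ys = ys ! k # drop (Suc k) ys"
      using k by (simp add: Cons_nth_drop_Suc)
    ultimately show ?thesis by (simp add: periodic_seq_def Suc k_def L_def)
  qed
  moreover have "z (Suc i) > 1" for i
    unfolding z_def using y1 ys by (auto intro!: cf_value_gt_1 dest!: in_set_dropD)
  moreover have "periodic_seq b0 ys (Suc i) \<ge> 1" "periodic_seq b0 ys i \<in> \<int>" for i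
    using nth assms(1) by (auto simp: periodic_seq_def L_def)
  ultimately have "simple_cf (periodic_seq b0 ys) (z 0)"
    by (intro simple_cf_complete_quotients) blast+
  then show ?thesis by (simp add: z_def ys_def)
qed

lemma simple_cf_tail:
  assumes "simple_cf c x"
  shows "\<exists>z>1. simple_cf (\<lambda>i. c (i + Suc n)) z \<and> x = c 0 + 1 / cf_value (map c [1..<n + 1]) z"
proof (induction n)
  case 0
  obtain y where "simple_cf (\<lambda>i. c (Suc i)) y" "x = c 0 + 1 / y" "y > 1"
    by (rule simple_cf_step[OF assms])
  then show ?case by (intro exI[of _ y]) simp
next
  case (Suc n)
  then obtain z where z: "simple_cf (\<lambda>i. c (i + Suc n)) z"
    "x = c 0 + 1 / cf_value (map c [1..<n + 1]) z" by auto
  obtain y where y: "simple_cf (\<lambda>i. c (Suc i + Suc n)) y" "z = c (0 + Suc n) + 1 / y" "y > 1"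
    by (rule simple_cf_step[OF z(1)])
  have "cf_value (map c [1..<Suc n + 1]) y = cf_value (map c [1..<n + 1]) z"
    using y(2) by (simp add: cf_value_append)
  with y z show ?case by (intro exI[of _ y]) simp
qed

lemma simple_cf_add_int:
  assumes "simple_cf c x" "k \<in> \<int>"
  shows "simple_cf (\<lambda>i. if i = 0 then c 0 + k else c i) (x + k)"
proof -
  have "convergent_cf (\<lambda>i. if i = 0 then c 0 + k else c i) = (\<lambda>m. convergent_cf c m + k)"
  proof
    show "convergent_cf (\<lambda>i. if i = 0 then c 0 + k else c i) m = convergent_cf c m + k" for m
      by (cases m) auto
  qed
  moreover have "(\<lambda>m. convergent_cf c m + k) \<longlonglongrightarrow> x + k"
    using assms(1) by (auto simp: simple_cf_def intro!: tendsto_add)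
  ultimately have "convergent_cf (\<lambda>i. if i = 0 then c 0 + k else c i) \<longlonglongrightarrow> x + k" by simp
  with assms show ?thesis by (auto simp: simple_cf_def)
qed

lemma simple_cf_limit_unique:
  "simple_cf c x \<Longrightarrow> simple_cf c y \<Longrightarrow> x = y"
  by (auto simp: simple_cf_def intro: LIMSEQ_unique)

lemma is_period_periodic_seq: "cs \<noteq> [] \<Longrightarrow> is_period (periodic_seq b0 cs) (length cs)"
proof -
  have "(i + length cs - 1) mod length cs = (i - 1) mod length cs" if "i \<ge> 1" for i
    using that by (cases i) auto
  then show "is_period (periodic_seq b0 cs) (length cs)" if "cs \<noteq> []"
    using that by (simp add: is_period_def periodic_seq_def)
qed

lemma map_periodic_seq:
  "m \<le> length cs \<Longrightarrow> map (periodic_seq b0 cs) [1..<m + 1] = take m cs"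
  by (intro nth_equalityI) (auto simp: periodic_seq_def simp del: upt_Suc)

text \<open>Converse of \<open>simple_cf_periodic_seq\<close>. After the quotients \<open>bs\<close>
  the expansion continues as that of \<open>x\<close> with \<open>2 * b0\<close> in place of
  \<open>b0\<close>, which is the expansion of \<open>x + b0\<close>; uniqueness of limits
  identifies the tail.\<close>

lemma cf_value_of_simple_cf_periodic:
  assumes "simple_cf (periodic_seq b0 (bs @ [2 * b0])) x"
  shows "x = b0 + 1 / cf_value bs (x + b0)"
proof -
  define c where "c = periodic_seq b0 (bs @ [2 * b0])"
  define n where "n = length bs"
  have c0: "c 0 = b0" and cn: "c (Suc n) = 2 * b0"
    by (simp_all add: c_def periodic_seq_def n_def)
  have per: "c (i + Suc n) = c i" if "i \<noteq> 0" for i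
    using is_period_periodic_seq[of "bs @ [2 * b0]" b0] that by (auto simp: is_period_def c_def n_def)
  have cf: "simple_cf c x" using assms by (simp add: c_def)
  obtain z where z: "simple_cf (\<lambda>i. c (i + Suc n)) z"
    "x = c 0 + 1 / cf_value (map c [1..<n + 1]) z"
    using simple_cf_tail[OF cf] by blast
  have "b0 \<in> \<int>" using cf by (auto simp: simple_cf_def c0[symmetric])
  moreover have "(\<lambda>i. c (i + Suc n)) = (\<lambda>i. if i = 0 then c 0 + b0 else c i)"
    using per by (auto simp: c0 cn fun_eq_iff)
  ultimately have zx: "z = x + b0"
    using z(1) simple_cf_add_int[OF cf, of b0] by (auto intro: simple_cf_limit_unique)
  have map: "map c [1..<n + 1] = bs"
    unfolding c_def by (subst map_periodic_seq) (auto simp: n_def)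
  show ?thesis using z(2) unfolding map zx c0 .
qed

text \<open>The Moebius form of \<open>cf_value\<close> turns the fixed point condition into a
  quadratic equation, arranged so that for symmetric \<open>M\<close> the terms linear in
  \<open>x\<close> cancel.\<close>

lemma periodic_cf_equation:
  assumes "\<forall>a\<in>set bs. a > 0" "x + b0 > 0"
  defines "M \<equiv> cf_matrix bs"
  shows "x = b0 + 1 / cf_value bs (x + b0) \<longleftrightarrow>
    M $ 1 $ 1 * (x\<^sup>2 - b0\<^sup>2) + M $ 1 $ 2 * (x - b0) = M $ 2 $ 1 * (x + b0) + M $ 2 $ 2"
proof -
  note v = cf_value_matrix[OF assms(1,2), folded M_def]
  have "x = b0 + 1 / (N / E) \<longleftrightarrow> (x - b0) * N = E" if "N > 0" for N E
    using that by (auto simp: divide_simps left_diff_distrib distrib_right)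
  from this[OF v(1)] have "x = b0 + 1 / cf_value bs (x + b0) \<longleftrightarrow>
    (x - b0) * (M $ 1 $ 1 * (x + b0) + M $ 1 $ 2) = M $ 2 $ 1 * (x + b0) + M $ 2 $ 2"
    unfolding v(3) .
  also have "(x - b0) * (M $ 1 $ 1 * (x + b0) + M $ 1 $ 2) =
    M $ 1 $ 1 * (x\<^sup>2 - b0\<^sup>2) + M $ 1 $ 2 * (x - b0)"
    by (simp add: algebra_simps power2_eq_square)
  finally show ?thesis .
qed

lemma cf_matrix_Ints:
  assumes "\<forall>a\<in>set xs. a \<in> (\<int> :: real set)"
  shows "cf_matrix xs $ i $ j \<in> \<int>"
  using assms
proof (induction xs arbitrary: i j)
  case Nil
  show ?case using exhaust_2[of i] exhaust_2[of j] by auto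
next
  case (Cons x xs)
  then show ?case using exhaust_2[of i] by auto
qed

text \<open>The two sides of the equation in \<open>periodic_cf_equation\<close> are compared as polynomials in the
  irrational number \<open>x\<close>, of which \<open>x\<^sup>2\<close> is rational.\<close>

lemma periodic_cf_symmetric:
  assumes "\<forall>a\<in>set bs. a \<in> \<int> \<and> a \<ge> 1" "b0 \<in> \<int>" "x\<^sup>2 \<in> \<int>" "x \<notin> \<rat>" "x + b0 > 0"
    and "x = b0 + 1 / cf_value bs (x + b0)"
  defines "M \<equiv> cf_matrix bs"
  shows "M $ 1 $ 2 = M $ 2 $ 1" "M $ 1 $ 1 * (x\<^sup>2 - b0\<^sup>2) = 2 * M $ 2 $ 1 * b0 + M $ 2 $ 2"
    "rev bs = bs"
proof -
  have pos: "\<forall>a\<in>set bs. a > 0" using assms(1) by auto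
  have int: "M $ i $ j \<in> \<int>" for i j unfolding M_def using assms(1) by (intro cf_matrix_Ints) auto
  have eq: "M $ 1 $ 1 * (x\<^sup>2 - b0\<^sup>2) + M $ 1 $ 2 * (x - b0) = M $ 2 $ 1 * (x + b0) + M $ 2 $ 2"
    using periodic_cf_equation[OF pos assms(5)] assms(6) by (simp add: M_def)
  define w where "w = M $ 2 $ 1 * b0 + M $ 2 $ 2 + M $ 1 $ 2 * b0 - M $ 1 $ 1 * (x\<^sup>2 - b0\<^sup>2)"
  have w: "(M $ 1 $ 2 - M $ 2 $ 1) * x = w" using eq by (simp add: w_def algebra_simps)
  have "w \<in> \<int>" unfolding w_def using int assms(2,3) by (intro Ints_add Ints_diff Ints_mult) (auto intro: Ints_power)
  show sym: "M $ 1 $ 2 = M $ 2 $ 1"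
  proof (rule ccontr)
    assume "M $ 1 $ 2 \<noteq> M $ 2 $ 1"
    then have "x = w / (M $ 1 $ 2 - M $ 2 $ 1)" using w by (simp add: field_simps)
    also have "\<dots> \<in> \<rat>"
      using \<open>w \<in> \<int>\<close> int by (intro Rats_divide Rats_diff) (use Ints_subset_Rats in blast)+
    finally show False using assms(4) by simp
  qed
  then show "M $ 1 $ 1 * (x\<^sup>2 - b0\<^sup>2) = 2 * M $ 2 $ 1 * b0 + M $ 2 $ 2"
    using eq by (simp add: algebra_simps)
  \<comment> \<open>By symmetry the reversed list has the same matrix, hence the same value at any
    positive argument; 2 is an arbitrary choice greater than 1.\<close>
  have "cf_value (rev bs) 2 = cf_value bs 2"
    using cf_value_matrix(3)[of bs 2] cf_value_matrix(3)[of "rev bs" 2] pos sym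
    by (simp add: cf_matrix_rev M_def)
  then show "rev bs = bs" by (rule cf_value_inject[rotated]) (use assms(1) in auto)
qed

section \<open>From solutions of the Pell equation to periods\<close>

lemma cf_matrix_factorization:
  fixes A B C E :: int
  assumes "A \<ge> B" "B \<ge> E" "A \<ge> C" "C \<ge> E" "E \<ge> 0" "\<bar>A * E - B * C\<bar> = 1"
  shows "\<exists>bs. (\<forall>b\<in>set bs. b \<ge> 1) \<and> cf_matrix bs $ 1 $ 1 = A \<and> cf_matrix bs $ 1 $ 2 = B \<and>
    cf_matrix bs $ 2 $ 1 = C \<and> cf_matrix bs $ 2 $ 2 = E"
  using assms
proof (induction "nat C" arbitrary: A B C E rule: less_induct)
  case less
  \<comment> \<open>\<open>C = 0\<close> would force \<open>E = 0\<close> and hence determinant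
    0.\<close>
  have "C \<noteq> 0" using less.prems by auto
  then consider "C = 1" "E = 0" | "C = 1" "E = 1" | "C \<ge> 2" using less.prems(4,5) by linarith
  then show ?case
  proof cases
    case 1
    then show ?thesis using less.prems by (intro exI[of _ "[A]"]) auto
  next
    case 2
    then show ?thesis using less.prems by (intro exI[of _ "[B, 1]"]) auto
  next
    case 3
    \<comment> \<open>One step of the Euclidean algorithm on the first column: splitting off
      \<open>b\<close> leaves the rows \<open>(C, E)\<close> and \<open>(A', B')\<close>.
      Determinant \<plusminus>1 and \<open>C \<ge> 2\<close> force \<open>B'\<close> to be
      nonnegative and at most \<open>A'\<close> and \<open>E\<close>.\<close>
    define b where "b = A div C"
    define A' where "A' = A mod C"
    define B' where "B' = B - b * E"
    have A': "A' = A - b * C" by (simp add: A'_def b_def minus_div_mult_eq_mod)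
    have A'C: "0 \<le> A'" "A' < C" using 3 by (simp_all add: A'_def)
    have b: "b \<ge> 1"
      unfolding b_def using less.prems(3) 3 zdiv_mono1[of C A C] by simp
    have "A' * E - B' * C = A * E - B * C" by (simp add: A' B'_def algebra_simps)
    with less.prems(6) have det': "\<bar>A' * E - B' * C\<bar> = 1" by simp
    have "B' \<ge> 0"
    proof (rule ccontr)
      assume "\<not> ?thesis"
      then have "B' * C \<le> (-1) * C" using 3 by (intro mult_right_mono) auto
      moreover have "A' * E \<ge> 0" using A'C less.prems(5) by simp
      ultimately show False using det' 3 by linarith
    qed
    moreover have "B' \<le> A'"
    proof (rule ccontr)
      assume "\<not> ?thesis"
      then have "(A' + 1) * C \<le> B' * C" using 3 by (intro mult_right_mono) auto
      moreover have "A' * E \<le> A' * C" using A'C less.prems(4) by (intro mult_left_mono) auto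
      ultimately show False using det' 3 by (simp add: distrib_right)
    qed
    moreover have "B' \<le> E"
    proof (rule ccontr)
      assume "\<not> ?thesis"
      then have "(E + 1) * C \<le> B' * C" using 3 by (intro mult_right_mono) auto
      moreover have "A' * E \<le> C * E" using A'C less.prems(5) by (intro mult_right_mono) auto
      ultimately show False using det' 3 by (simp add: algebra_simps)
    qed
    moreover have "\<bar>C * B' - E * A'\<bar> = 1" using det' by (simp add: mult.commute abs_minus_commute)
    ultimately obtain bs where "\<forall>b\<in>set bs. b \<ge> 1" "cf_matrix bs $ 1 $ 1 = C"
      "cf_matrix bs $ 1 $ 2 = E" "cf_matrix bs $ 2 $ 1 = A'" "cf_matrix bs $ 2 $ 2 = B'"
      using less.hyps[of A' E C B'] A'C less.prems by auto
    then show ?thesis using b by (intro exI[of _ "b # bs"]) (auto simp: A' B'_def)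
  qed
qed

text \<open>If \<open>x + y \<surd>D\<close> has norm \<open>\<plusminus>1\<close>, then \<open>\<surd>D = [a; bs, a + \<surd>D]\<close> holds for the factorization
  \<open>bs\<close> of the symmetric matrix with first column \<open>y, x - a y\<close>; the condition on its last entry
  is the equation for periodic continued fractions.\<close>

lemma pell_factorization:
  fixes x y a D s :: int
  assumes "x > 0" "y > 0" "a \<ge> 1" "a\<^sup>2 < D" "D \<le> a\<^sup>2 + 2 * a" "x\<^sup>2 - D * y\<^sup>2 = s" "\<bar>s\<bar> = 1"
  shows "\<exists>bs. (\<forall>b\<in>set bs. b \<ge> 1) \<and> cf_matrix bs $ 1 $ 1 = y \<and> cf_matrix bs $ 1 $ 2 = x - a * y \<and>
    cf_matrix bs $ 2 $ 1 = x - a * y \<and>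
    cf_matrix bs $ 2 $ 2 = (D - a\<^sup>2) * y - 2 * a * (x - a * y)"
proof -
  define u where "u = x - a * y"
  define R where "R = (D - a\<^sup>2) * y - 2 * a * u"
  have x: "x = u + a * y" by (simp add: u_def)
  have det: "y * R - u\<^sup>2 = - s"
    using assms(6) by (simp add: x R_def power2_eq_square algebra_simps)
  have y2: "y\<^sup>2 \<ge> 1" using assms(2) by (simp add: int_one_le_iff_zero_less)
  \<comment> \<open>Both bounds on \<open>u\<close> reflect that \<open>sqrt D\<close> lies between
    \<open>a\<close> and \<open>a + 1\<close>: a negative \<open>u\<close> makes the norm less than
    -1, and \<open>u > y\<close> makes it greater than 1.\<close>
  have "u \<ge> 0"
  proof (rule ccontr)
    assume "\<not> ?thesis"
    then have "x < a * y" by (simp add: u_def)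
    then have "x\<^sup>2 \<le> (a * y - 1)\<^sup>2" using assms(1) by (intro power_mono) auto
    moreover have "(a\<^sup>2 + 1) * y\<^sup>2 \<le> D * y\<^sup>2" using assms(4) by (intro mult_right_mono) auto
    moreover have "a * y \<ge> 1" using assms(2,3) by (simp add: int_one_le_iff_zero_less)
    ultimately show False using assms(6,7) y2 by (simp add: power2_eq_square algebra_simps)
  qed
  have "u \<le> y"
  proof (rule ccontr)
    assume "\<not> ?thesis"
    then have "(a + 1) * y + 1 \<le> x" by (simp add: u_def algebra_simps)
    then have "((a + 1) * y + 1)\<^sup>2 \<le> x\<^sup>2" using assms(2,3) by (intro power_mono) auto
    moreover have "D * y\<^sup>2 \<le> (a\<^sup>2 + 2 * a) * y\<^sup>2" using assms(5) by (intro mult_right_mono) auto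
    moreover have "a * y \<ge> 1" using assms(2,3) by (simp add: int_one_le_iff_zero_less)
    ultimately show False using assms(2,6,7) y2 by (simp add: power2_eq_square algebra_simps)
  qed
  show ?thesis
  \<comment> \<open>For \<open>u = 0\<close> one gets \<open>y = R = 1\<close>, the identity matrix
    and the empty list; its entries violate the ordering required by
    \<open>cf_matrix_factorization\<close>.\<close>
  proof (cases "u = 0")
    case True
    then have "y * R = - s" using det by simp
    then have "\<bar>y * R\<bar> = 1" using assms(7) by simp
    then have "y = 1" "\<bar>R\<bar> = 1" using assms(2) by (auto simp: abs_mult zmult_eq_1_iff)
    moreover have "R > 0" using True \<open>y = 1\<close> assms(4) by (simp add: R_def)
    ultimately show ?thesis
      unfolding u_def[symmetric] R_def[symmetric] using True by (intro exI[of _ "[]"]) simp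
  next
    case False
    then have u: "u \<ge> 1" using \<open>u \<ge> 0\<close> by simp
    have "u\<^sup>2 \<ge> 1" using u by (simp add: int_one_le_iff_zero_less)
    then have "y * R \<ge> 0" using det assms(7) by linarith
    then have "R \<ge> 0" using assms(2) by (simp add: zero_le_mult_iff)
    \<comment> \<open>The determinant permits \<open>R > u\<close> only for
      \<open>y = u = 1\<close>, where \<open>R = D - a\<^sup>2 - 2 * a \<le> 0\<close>.\<close>
    moreover have "R \<le> u"
    proof (rule ccontr)
      assume R: "\<not> ?thesis"
      then have "y * (u + 1) \<le> y * R" using assms(2) by (intro mult_left_mono) auto
      moreover have "u * u \<le> y * u" using \<open>u \<le> y\<close> u by (intro mult_right_mono) auto
      ultimately have "y \<le> 1" using det assms(7) by (simp add: power2_eq_square algebra_simps)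
      then have "y = 1" "u = 1" using \<open>u \<le> y\<close> u by auto
      then show False using R assms(5) by (simp add: R_def)
    qed
    moreover have "\<bar>y * R - u * u\<bar> = 1" using det assms(7) by (simp add: power2_eq_square)
    ultimately show ?thesis
      unfolding u_def[symmetric] R_def[symmetric] using cf_matrix_factorization[of u y R u] \<open>u \<le> y\<close> by auto
  qed
qed

lemma cf_matrix_nonneg:
  assumes "\<forall>a\<in>set xs. a \<ge> (0 :: real)"
  shows "cf_matrix xs $ i $ j \<ge> 0"
  using assms
proof (induction xs arbitrary: i j)
  case Nil
  show ?case using exhaust_2[of i] exhaust_2[of j] by auto
next
  case (Cons x xs)
  then show ?case using exhaust_2[of i] by auto
qed

lemma Q_rec_pos_mono:
  fixes a :: "nat \<Rightarrow> real"
  assumes "\<And>i. i \<ge> 1 \<Longrightarrow> a i \<ge> 1"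
  shows "Q_rec a n > 0" "m \<le> n \<Longrightarrow> Q_rec a m \<le> Q_rec a n"
proof -
  have step: "Q_rec a n > 0 \<and> Q_rec a n \<le> Q_rec a (Suc n)" for n
  proof (induction n)
    case 0
    show ?case using assms[of 1] by simp
  next
    case (Suc n)
    then have "Q_rec a (Suc n) \<le> a (Suc (Suc n)) * Q_rec a (Suc n)"
      using assms[of "Suc (Suc n)"] mult_right_mono[of 1 "a (Suc (Suc n))" "Q_rec a (Suc n)"] by simp
    with Suc show ?case unfolding Q_rec.simps(3) by linarith
  qed
  show "Q_rec a n > 0" using step by blast
  show "Q_rec a m \<le> Q_rec a n" if "m \<le> n"
    using lift_Suc_mono_le[of "Q_rec a" m n] step that by blast
qed

text \<open>Every competing solution gives, by \<open>pell_factorization\<close> and uniqueness of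
  the expansion, a period \<open>length ds + 1\<close>. The sign of the norm fixes its parity, so it
  is not shorter than \<open>n + 1\<close>, and monotonicity of \<open>Q_rec\<close> compares the
  two solutions.\<close>

lemma fundamental_solution_periodic:
  fixes D :: int and bs :: "real list"
  assumes bs: "\<forall>a\<in>set bs. a \<in> \<int> \<and> a \<ge> 1" and b0: "b0 \<in> \<int>" "b0 > 0"
  defines "c \<equiv> periodic_seq b0 (bs @ [2 * b0])" and "M \<equiv> cf_matrix bs" and "n \<equiv> length bs"
  assumes cf: "simple_cf c (sqrt D)" and least: "no_shorter_period_same_parity c (n + 1)"
  shows "fundamental_solution D ((-1) ^ (n + 1)) (b0 * M $ 1 $ 1 + M $ 2 $ 1) (M $ 1 $ 1)"
proof -
  have bs_pos: "\<forall>a\<in>set bs. a > 0" "\<forall>a\<in>set bs. a \<ge> 0" using bs by auto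
  obtain a :: int where a: "b0 = a" using b0 by (auto elim: Ints_cases)
  have a1: "a \<ge> 1" using b0 a by simp
  have c0: "c 0 = b0" by (simp add: c_def periodic_seq_def)
  have c_ge: "c i \<ge> 1" if "i \<ge> 1" for i by (rule simple_cf_ge_1[OF cf that])
  obtain y where "sqrt D = b0 + 1 / y" "y > 1" using simple_cf_step[OF cf] c0 by metis
  \<comment> \<open>Thus \<open>a\<close> is the integer part of \<open>sqrt D\<close>, which
    supplies the bounds required by \<open>pell_factorization\<close>.\<close>
  then have floor: "b0 < sqrt D" "sqrt D < b0 + 1" by auto
  have D0: "D > 0" using floor(1) b0 by (smt (verit) of_int_le_0_iff real_sqrt_le_0_iff)
  then have sq: "(sqrt D)\<^sup>2 = D" by simp
  have "a\<^sup>2 < D"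
    using power_strict_mono[OF floor(1), of 2] b0 sq a by (simp flip: of_int_power)
  have "of_int D < (b0 + 1)\<^sup>2"
    using power_strict_mono[OF floor(2), of 2] D0 sq by simp
  then have "real_of_int D < real_of_int ((a + 1)\<^sup>2)" by (simp add: a)
  then have "D < (a + 1)\<^sup>2" by linarith
  then have "D \<le> a\<^sup>2 + 2 * a" by (simp add: power2_eq_square algebra_simps)
  have eq: "sqrt D = b0 + 1 / cf_value bs (sqrt D + b0)"
    using cf unfolding c_def by (rule cf_value_of_simple_cf_periodic)
  have sym: "M $ 1 $ 2 = M $ 2 $ 1" "M $ 1 $ 1 * (D - b0\<^sup>2) = 2 * M $ 2 $ 1 * b0 + M $ 2 $ 2"
    using periodic_cf_symmetric(1,2)[OF bs b0(1) _ simple_cf_irrational[OF cf] _ eq] b0 D0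
    by (simp_all add: M_def sq add_nonneg_pos)
  have int: "M $ i $ j \<in> \<int>" for i j unfolding M_def using bs by (intro cf_matrix_Ints) auto
  have map_c: "map c [1..<n + 1] = bs"
    unfolding c_def by (subst map_periodic_seq) (simp_all add: n_def)
  have M_Q: "M $ 1 $ 1 = Q_rec c n"
    unfolding M_def map_c[symmetric] by (rule cf_matrix_rec)
  then have M_pos: "M $ 1 $ 1 > 0" using Q_rec_pos_mono(1)[of c, OF c_ge] by simp
  have M_nonneg: "M $ 2 $ 1 \<ge> 0" unfolding M_def by (rule cf_matrix_nonneg[OF bs_pos(2)])
  have det: "M $ 1 $ 1 * M $ 2 $ 2 - M $ 2 $ 1 * M $ 2 $ 1 = (-1) ^ n"
    using cf_matrix_det[of bs] sym(1) by (simp add: M_def n_def)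
  define C where "C = b0 * M $ 1 $ 1 + M $ 2 $ 1"
  have C_pos: "C > 0" using b0 M_pos M_nonneg by (simp add: C_def add_pos_nonneg)
  have "C\<^sup>2 - D * (M $ 1 $ 1)\<^sup>2 =
    M $ 2 $ 1 * M $ 2 $ 1 - M $ 1 $ 1 * (M $ 1 $ 1 * (D - b0\<^sup>2) - 2 * M $ 2 $ 1 * b0)"
    by (simp add: C_def power2_eq_square algebra_simps)
  also have "\<dots> = (-1) ^ (n + 1)" using det by (simp add: sym(2))
  finally have C: "C\<^sup>2 - D * (M $ 1 $ 1)\<^sup>2 = (-1) ^ (n + 1)" .
  have "C + M $ 1 $ 1 * sqrt D \<le> x' + y' * sqrt D"
    if sol: "pell_solution D ((-1) ^ (n + 1)) x' y'" for x' y'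
  proof -
    obtain x y :: int where xy: "x' = x" "y' = y"
      using sol by (auto simp: pell_solution_def elim!: Ints_cases)
    have pos: "x > 0" "y > 0" using sol by (auto simp: pell_solution_def xy)
    have "real_of_int (x\<^sup>2 - D * y\<^sup>2) = real_of_int ((-1) ^ (n + 1))"
      using sol by (simp add: pell_solution_def xy)
    then have s: "x\<^sup>2 - D * y\<^sup>2 = (-1) ^ (n + 1)" by (simp only: of_int_eq_iff)
    obtain ds where ds: "\<forall>b\<in>set ds. b \<ge> 1" "cf_matrix ds $ 1 $ 1 = y"
      "cf_matrix ds $ 1 $ 2 = x - a * y" "cf_matrix ds $ 2 $ 1 = x - a * y"
      "cf_matrix ds $ 2 $ 2 = (D - a\<^sup>2) * y - 2 * a * (x - a * y)"
      using pell_factorization[OF pos a1 \<open>a\<^sup>2 < D\<close> \<open>D \<le> a\<^sup>2 + 2 * a\<close> s] by (auto simp: power_abs)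
    define es where "es = map real_of_int ds"
    have es: "\<forall>a\<in>set es. a \<in> \<int> \<and> a \<ge> 1" "\<forall>a\<in>set es. a > 0" using ds(1) by (auto simp: es_def)
    have eq': "sqrt D = b0 + 1 / cf_value es (sqrt D + b0)"
      using b0 D0
      by (subst periodic_cf_equation[OF es(2)])
        (simp_all add: add_nonneg_pos es_def cf_matrix_of_int ds(2-) a algebra_simps)
    have "sqrt D > 0" using D0 by simp
    then have "simple_cf (periodic_seq b0 (es @ [2 * b0])) (sqrt D)"
      by (rule simple_cf_periodic_seq[OF b0 es(1) _ eq'])
    then have c_es: "c = periodic_seq b0 (es @ [2 * b0])" by (rule simple_cf_unique[OF cf])
    have "is_period c (length ds + 1)"
      using is_period_periodic_seq[of "es @ [2 * b0]" b0] by (simp add: c_es es_def)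
    \<comment> \<open>The determinant of the matrix of \<open>ds\<close> is minus the norm of the
      solution, so both lists have lengths of the same parity.\<close>
    moreover have "(-1) ^ length ds = (-1 :: int) ^ n"
      using cf_matrix_det[of ds] s by (simp add: ds(2-) power2_eq_square algebra_simps)
    then have "even (length ds + 1) = even (n + 1)"
      by (cases "even n"; cases "even (length ds)") auto
    ultimately have "n \<le> length ds"
      using least by (auto simp: no_shorter_period_same_parity_def)
    have "map c [1..<length ds + 1] = es"
      unfolding c_es by (subst map_periodic_seq) (simp_all add: es_def)
    then have "y' = Q_rec c (length ds)"
      using cf_matrix_rec(1)[of c "length ds"] ds(2) by (simp add: es_def cf_matrix_of_int xy)
    then have y_le: "M $ 1 $ 1 \<le> y'"
      using Q_rec_pos_mono(2)[of c, OF c_ge \<open>n \<le> length ds\<close>] by (simp add: M_Q)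
    \<comment> \<open>At equal norm, the second components determine the order of the first
      ones.\<close>
    then have "(M $ 1 $ 1)\<^sup>2 \<le> y'\<^sup>2" using M_pos by (intro power_mono) auto
    then have "D * (M $ 1 $ 1)\<^sup>2 \<le> D * y'\<^sup>2" using D0 by (intro mult_left_mono) auto
    moreover have "x'\<^sup>2 - D * y'\<^sup>2 = (-1) ^ (n + 1)" using sol unfolding pell_solution_def by blast
    ultimately have "C\<^sup>2 \<le> x'\<^sup>2" using C by linarith
    then have "C \<le> x'" by (rule power2_le_imp_le) (use pos xy in simp)
    with y_le show ?thesis using D0 by (intro add_mono mult_right_mono) auto
  qed
  moreover have "pell_solution D ((-1) ^ (n + 1)) C (M $ 1 $ 1)"
    using C C_pos M_pos int b0 by (simp add: pell_solution_def C_def)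
  ultimately show ?thesis by (simp add: fundamental_solution_def C_def)
qed

section \<open>Integer polynomials and their values\<close>

lemma eval_at_superset:
  assumes "finite S" "Poly_Mapping.keys p \<subseteq> S"
  shows "eval_at t p = (\<Sum>m\<in>S. Poly_Mapping.lookup p m *
    (\<Prod>i\<in>Poly_Mapping.keys m. t i ^ Poly_Mapping.lookup m i))"
  unfolding eval_at_def using assms
  by (intro sum.mono_neutral_left) (auto simp: in_keys_iff)

lemma eval_at_single [simp]:
  "eval_at t (Poly_Mapping.single m c) =
    c * (\<Prod>i\<in>Poly_Mapping.keys m. t i ^ Poly_Mapping.lookup m i)"
  by (subst eval_at_superset[of "{m}"]) auto

lemma eval_at_add [simp]: "eval_at t (p + q) = eval_at t p + eval_at t q"
proof -
  let ?S = "Poly_Mapping.keys p \<union> Poly_Mapping.keys q"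
  have "finite ?S" by simp
  note superset = eval_at_superset[OF this]
  show ?thesis
    using superset[of "p + q" t] superset[of p t] superset[of q t] Poly_Mapping.keys_add[of p q]
    by (simp add: lookup_add distrib_right sum.distrib)
qed

lemma eval_at_0 [simp]: "eval_at t 0 = 0"
  by (simp add: eval_at_def)

lemma eval_at_sum: "eval_at t (\<Sum>x\<in>A. f x) = (\<Sum>x\<in>A. eval_at t (f x))"
  by (induction A rule: infinite_finite_induct) auto

lemma eval_at_Cst [simp]: "eval_at t (Cst c) = c"
  by (simp add: Cst_def)

lemma eval_at_1 [simp]: "eval_at t 1 = 1"
  using eval_at_Cst[of t 1] by (simp add: Cst_def)

lemma eval_at_uminus [simp]: "eval_at t (- p) = - eval_at t p"
  using eval_at_add[of t p "- p"] by simp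

lemma eval_at_diff [simp]: "eval_at t (p - q) = eval_at t p - eval_at t q"
  using eval_at_add[of t p "- q"] by simp

lemma eval_at_Var [simp]: "eval_at t (Var i) = t i"
  by (simp add: Var_def)

lemma poly_mapping_eq_sum_single:
  "p = (\<Sum>m\<in>Poly_Mapping.keys p. Poly_Mapping.single m (Poly_Mapping.lookup p m))"
  by (rule poly_mapping_eqI) (auto simp: lookup_sum lookup_single when_def in_keys_iff)

lemma poly_mapping_mult_eq_sum:
  "p * q = (\<Sum>m\<in>Poly_Mapping.keys p. \<Sum>m'\<in>Poly_Mapping.keys q.
    Poly_Mapping.single (m + m') (Poly_Mapping.lookup p m * Poly_Mapping.lookup q m'))"
  by (subst poly_mapping_eq_sum_single[of p], subst poly_mapping_eq_sum_single[of q])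
    (simp add: sum_product mult_single)

lemma prod_power_keys_add:
  fixes t :: "nat \<Rightarrow> real" and m m' :: "nat \<Rightarrow>\<^sub>0 nat"
  shows "(\<Prod>i\<in>Poly_Mapping.keys (m + m'). t i ^ Poly_Mapping.lookup (m + m') i) =
    (\<Prod>i\<in>Poly_Mapping.keys m. t i ^ Poly_Mapping.lookup m i) *
    (\<Prod>i\<in>Poly_Mapping.keys m'. t i ^ Poly_Mapping.lookup m' i)"
proof -
  define S where "S = Poly_Mapping.keys m \<union> Poly_Mapping.keys m'"
  have superset: "(\<Prod>i\<in>Poly_Mapping.keys n. t i ^ Poly_Mapping.lookup n i) =
    (\<Prod>i\<in>S. t i ^ Poly_Mapping.lookup n i)" if "Poly_Mapping.keys n \<subseteq> S" for n
    using that by (intro prod.mono_neutral_left) (auto simp: in_keys_iff S_def)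
  show ?thesis
    using superset[of m] superset[of m'] superset[of "m + m'"] Poly_Mapping.keys_add[of m m']
    by (simp add: S_def lookup_add power_add prod.distrib)
qed

text \<open>Both factors are expanded into monomials, on which evaluation turns sums of exponents
  into products.\<close>

lemma eval_at_mult [simp]: "eval_at t (p * q) = eval_at t p * eval_at t q"
proof -
  have "eval_at t (p * q) = (\<Sum>m\<in>Poly_Mapping.keys p. \<Sum>m'\<in>Poly_Mapping.keys q.
    (Poly_Mapping.lookup p m * (\<Prod>i\<in>Poly_Mapping.keys m. t i ^ Poly_Mapping.lookup m i)) *
    (Poly_Mapping.lookup q m' * (\<Prod>i\<in>Poly_Mapping.keys m'. t i ^ Poly_Mapping.lookup m' i)))"
    by (simp add: poly_mapping_mult_eq_sum[of p] eval_at_sum prod_power_keys_add mult_ac)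
  also have "\<dots> = eval_at t p * eval_at t q"
    by (simp add: eval_at_def sum_product)
  finally show ?thesis .
qed

lemma eval_at_power [simp]: "eval_at t (p ^ n) = eval_at t p ^ n"
  by (induction n) auto

lemma eval_at_numeral [simp]: "eval_at t (numeral n) = numeral n"
  using eval_at_Cst[of t "numeral n"] by (simp add: Cst_def)

text \<open>The set of variables is a parameter because \<open>P_poly\<close> and
  \<open>Q_poly\<close> do not involve the variable 0, whose value may be a half-integer;
  \<open>eval_at_Ints\<close> still applies to them.\<close>

definition int_polys_in :: "nat set \<Rightarrow> mpoly set" where
  "int_polys_in V = {p. \<forall>m\<in>Poly_Mapping.keys p.
     Poly_Mapping.lookup p m \<in> \<int> \<and> Poly_Mapping.keys m \<subseteq> V}"

lemma int_polys_eq: "int_polys k = int_polys_in {0..k}"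
  by (simp add: int_polys_def int_polys_in_def)

lemma int_polys_in_mono: "V \<subseteq> W \<Longrightarrow> int_polys_in V \<subseteq> int_polys_in W"
  by (auto simp: int_polys_in_def)

lemma int_polys_in_lookup: "p \<in> int_polys_in V \<Longrightarrow> Poly_Mapping.lookup p m \<in> \<int>"
  by (cases "m \<in> Poly_Mapping.keys p") (auto simp: int_polys_in_def in_keys_iff)

lemma int_polys_in_add: "p \<in> int_polys_in V \<Longrightarrow> q \<in> int_polys_in V \<Longrightarrow> p + q \<in> int_polys_in V"
  using Poly_Mapping.keys_add[of p q] int_polys_in_lookup[of p V] int_polys_in_lookup[of q V]
  by (auto simp: int_polys_in_def lookup_add)

lemma int_polys_in_single:
  "c \<in> \<int> \<Longrightarrow> Poly_Mapping.keys m \<subseteq> V \<Longrightarrow> Poly_Mapping.single m c \<in> int_polys_in V"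
  by (auto simp: int_polys_in_def)

lemma int_polys_in_0: "0 \<in> int_polys_in V"
  by (simp add: int_polys_in_def)

lemma int_polys_in_sum:
  "(\<And>x. x \<in> A \<Longrightarrow> f x \<in> int_polys_in V) \<Longrightarrow> (\<Sum>x\<in>A. f x) \<in> int_polys_in V"
  by (induction A rule: infinite_finite_induct) (auto intro: int_polys_in_add int_polys_in_0)

lemma int_polys_in_mult:
  assumes "p \<in> int_polys_in V" "q \<in> int_polys_in V"
  shows "p * q \<in> int_polys_in V"
proof -
  have "(\<Sum>m\<in>Poly_Mapping.keys p. \<Sum>m'\<in>Poly_Mapping.keys q.
    Poly_Mapping.single (m + m') (Poly_Mapping.lookup p m * Poly_Mapping.lookup q m')) \<in> int_polys_in V"
  proof (intro int_polys_in_sum int_polys_in_single)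
    fix m m' assume "m \<in> Poly_Mapping.keys p" "m' \<in> Poly_Mapping.keys q"
    then show "Poly_Mapping.lookup p m * Poly_Mapping.lookup q m' \<in> \<int>"
      using assms by (simp_all add: int_polys_in_def)
    show "Poly_Mapping.keys (m + m') \<subseteq> V"
      using assms \<open>m \<in> _\<close> \<open>m' \<in> _\<close> Poly_Mapping.keys_add[of m m']
      unfolding int_polys_in_def by blast
  qed
  then show ?thesis by (simp add: poly_mapping_mult_eq_sum[of p])
qed

lemma int_polys_in_1: "1 \<in> int_polys_in V"
  using int_polys_in_single[of 1 0 V] by simp

lemma int_polys_in_of_int: "of_int c \<in> int_polys_in V"
  using int_polys_in_single[of "of_int c" 0 V] by simp

lemma int_polys_in_uminus: "p \<in> int_polys_in V \<Longrightarrow> - p \<in> int_polys_in V"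
  using int_polys_in_mult[OF int_polys_in_of_int[of "-1" V]] by fastforce

lemma int_polys_in_power: "p \<in> int_polys_in V \<Longrightarrow> p ^ n \<in> int_polys_in V"
  by (induction n) (auto intro: int_polys_in_mult int_polys_in_1)

lemma int_polys_in_numeral: "numeral c \<in> int_polys_in V"
  using int_polys_in_of_int[of "numeral c" V] by simp

lemma int_polys_in_Var: "i \<in> V \<Longrightarrow> Var i \<in> int_polys_in V"
  unfolding Var_def by (intro int_polys_in_single) auto

lemmas int_polys_in_intros = int_polys_in_add int_polys_in_mult int_polys_in_uminus
  int_polys_in_power int_polys_in_0 int_polys_in_1 int_polys_in_of_int int_polys_in_numeral
  int_polys_in_Var

lemma eval_at_Ints:
  assumes "p \<in> int_polys_in V" "\<And>i. i \<in> V \<Longrightarrow> t i \<in> \<int>"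
  shows "eval_at t p \<in> \<int>"
  unfolding eval_at_def using assms
  by (intro Ints_sum Ints_mult Ints_prod Ints_power) (auto simp: int_polys_in_def)

text \<open>Relational parametricity of the recurrences. It covers homomorphisms, membership in a
  subring, and congruences.\<close>

lemma rec_related:
  assumes "R 0 0" "R 1 1" "\<And>x y x' y'. R x y \<Longrightarrow> R x' y' \<Longrightarrow> R (x + x') (y + y')"
    "\<And>x y x' y'. R x y \<Longrightarrow> R x' y' \<Longrightarrow> R (x * x') (y * y')"
    "\<And>i. 1 \<le> i \<Longrightarrow> i \<le> n \<Longrightarrow> R (a i) (b i)"
  shows "m \<le> n \<Longrightarrow> R (P_rec a m) (P_rec b m)" "m \<le> n \<Longrightarrow> R (Q_rec a m) (Q_rec b m)"
proof -
  have "(m \<le> n \<longrightarrow> R (P_rec a m) (P_rec b m)) \<and> (m \<le> n \<longrightarrow> R (Q_rec a m) (Q_rec b m))"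
  proof (induction m rule: induct_nat_012)
    case 1
    have "R (a 1 * 0 + 1) (b 1 * 0 + 1)" "R (a 1 * 1 + 0) (b 1 * 1 + 0)" if "n \<ge> 1"
      using assms that by blast+
    then show ?case by simp
  next
    case (ge2 m)
    then show ?case unfolding P_rec.simps Q_rec.simps using assms(3-5) by simp
  qed (use assms in auto)
  then show "m \<le> n \<Longrightarrow> R (P_rec a m) (P_rec b m)" "m \<le> n \<Longrightarrow> R (Q_rec a m) (Q_rec b m)"
    by blast+
qed

lemma eval_at_P_poly: "eval_at t (P_poly n e m) = P_rec (\<lambda>i. eval_at t (a_poly n e i)) m"
  unfolding P_poly_def by (rule rec_related(1)[where R = "\<lambda>x y. eval_at t x = y" and n = m]) simp_all

lemma eval_at_Q_poly: "eval_at t (Q_poly n e m) = Q_rec (\<lambda>i. eval_at t (a_poly n e i)) m"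
  unfolding Q_poly_def by (rule rec_related(2)[where R = "\<lambda>x y. eval_at t x = y" and n = m]) simp_all

text \<open>The element \<open>W\<close> stands for \<open>Q\<^sub>n\<^sub>-\<^sub>1 P\<^sub>n\<^sub>-\<^sub>1 / 2\<close>, which avoids the division in the definition of \<open>a\<^sub>0\<close>.\<close>

lemma F_poly_identity:
  fixes A Q Q' P' T W s :: "'a::comm_ring_1"
  assumes "Q * P' - Q' * Q' = s" "s * s = 1" "Q' * P' = 2 * W" "A = s * W + T * Q"
  defines "F \<equiv> A\<^sup>2 + 2 * T * Q' + s * P'\<^sup>2"
  shows "Q * (F - A\<^sup>2) = 2 * Q' * A + P'" "(A * Q + Q')\<^sup>2 - F * Q\<^sup>2 = - s"
proof -
  have "Q * (F - A\<^sup>2) - (2 * Q' * A + P') = s * P' * (Q * P') - 2 * s * W * Q' - P'"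
    by (simp add: F_def assms(4) power2_eq_square algebra_simps)
  also have "2 * s * W * Q' = s * Q' * (Q' * P')" unfolding assms(3) by (simp add: mult_ac)
  also have "s * P' * (Q * P') - s * Q' * (Q' * P') - P' = P' * (s * (Q * P' - Q' * Q') - 1)"
    by (simp add: algebra_simps)
  also have "\<dots> = 0" by (simp add: assms(1,2))
  finally show eq: "Q * (F - A\<^sup>2) = 2 * Q' * A + P'" by simp
  have "(A * Q + Q')\<^sup>2 - F * Q\<^sup>2 = 2 * A * Q * Q' + Q' * Q' - Q * (Q * (F - A\<^sup>2))"
    by (simp add: power2_eq_square algebra_simps)
  also have "\<dots> = - (Q * P' - Q' * Q')" unfolding eq by (simp add: algebra_simps)
  finally show "(A * Q + Q')\<^sup>2 - F * Q\<^sup>2 = - s" by (simp add: assms(1))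
qed

section \<open>The polynomials of a permissible sequence\<close>

text \<open>The swap matrix exchanges the rows, so the right column is
  \<open>(P\<^sub>n\<^sub>-\<^sub>1, Q\<^sub>n\<^sub>-\<^sub>1)\<close> of the zero-one sequence. It
  differs from (1, 1) modulo 2 exactly if the product of its entries is even.\<close>

lemma permissible_iff:
  assumes "n \<ge> 1"
  shows "permissible n e \<longleftrightarrow> length e = n \<and> set e \<subseteq> {0, 1} \<and> symmetric_seq n e \<and>
    even (Q_rec (\<lambda>i. int (entry e i)) (n - 1) * P_rec (\<lambda>i. int (entry e i)) (n - 1))"
proof (cases "length e = n")
  case True
  have "permissible_matrix e =
    vector [vector [0, 1], vector [1, 0]] ** cf_matrix (map int e)"
    by (simp add: permissible_matrix_def cf_matrix_def quotient_matrix_def foldr_map comp_def)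
  then have M: "permissible_matrix e $ 1 $ 2 = cf_matrix (map int e) $ 2 $ 2"
    "permissible_matrix e $ 2 $ 2 = cf_matrix (map int e) $ 1 $ 2"
    by (simp_all add: matrix_matrix_mult_def sum_2)
  have "map int e = map (\<lambda>i. int (entry e i)) [1..<n + 1]"
    using True by (intro nth_equalityI) (auto simp: entry_def simp del: upt_Suc)
  then have M': "cf_matrix (map int e) $ 2 $ 2 = P_rec (\<lambda>i. int (entry e i)) (n - 1)"
    "cf_matrix (map int e) $ 1 $ 2 = Q_rec (\<lambda>i. int (entry e i)) (n - 1)"
    by (simp_all only: cf_matrix_rec(3,4)[OF assms])
  show ?thesis unfolding permissible_def M M' using True by (auto simp: cong_def odd_iff_mod_2_eq_one)
qed (simp add: permissible_def)

text \<open>The matrix of a palindrome equals its transpose by \<open>cf_matrix_rev\<close>; the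
  second equation is then its determinant.\<close>

lemma rec_symmetric:
  fixes a :: "nat \<Rightarrow> 'a::comm_ring_1"
  assumes "n \<ge> 1" "\<And>i. 1 \<le> i \<Longrightarrow> i \<le> n \<Longrightarrow> a (n + 1 - i) = a i"
  shows "P_rec a n = Q_rec a (n - 1)"
    "Q_rec a n * P_rec a (n - 1) - Q_rec a (n - 1) * Q_rec a (n - 1) = (-1) ^ n"
proof -
  define xs where "xs = map a [1..<n + 1]"
  have "length xs = n" by (simp add: xs_def del: upt_Suc)
  have "rev xs = xs"
  proof (intro nth_equalityI)
    fix i assume "i < length (rev xs)"
    with \<open>length xs = n\<close> have "i < n" by simp
    then show "rev xs ! i = xs ! i"
      using assms(2)[of "Suc i"] by (simp add: xs_def rev_nth Suc_diff_Suc del: upt_Suc)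
  qed simp
  then show sym: "P_rec a n = Q_rec a (n - 1)"
    using cf_matrix_rev[of xs 1 2] cf_matrix_rec(2)[of a n, folded xs_def]
      cf_matrix_rec(3)[OF assms(1), of a, folded xs_def] by simp
  show "Q_rec a n * P_rec a (n - 1) - Q_rec a (n - 1) * Q_rec a (n - 1) = (-1) ^ n"
    using cf_matrix_det[of xs] cf_matrix_rec(1,2)[of a n, folded xs_def]
      cf_matrix_rec(3,4)[OF assms(1), of a, folded xs_def] sym
      \<open>length xs = n\<close>
    by simp
qed

lemma a_poly_symmetric: "1 \<le> i \<Longrightarrow> i \<le> n \<Longrightarrow> a_poly n e (n + 1 - i) = a_poly n e i"
  by (simp add: a_poly_def min.commute)

lemma entry_min:
  assumes "permissible n e" "1 \<le> i" "i \<le> n"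
  shows "entry e (min i (n + 1 - i)) = entry e i" "entry e i \<in> {0, 1}"
proof -
  have "entry e i = entry e (n + 1 - i)"
    using assms by (auto simp: permissible_def symmetric_seq_def)
  then show "entry e (min i (n + 1 - i)) = entry e i" by (simp add: min_def)
  have "entry e i \<in> set e" using assms by (auto simp: permissible_def entry_def)
  then show "entry e i \<in> {0, 1}" using assms(1) by (auto simp: permissible_def)
qed

lemma a_poly_mod_2:
  assumes "permissible n e" "1 \<le> i" "i \<le> n"
  shows "\<exists>h\<in>int_polys_in {1..(n + 1) div 2}. a_poly n e i = of_int (int (entry e i)) + 2 * h"
proof -
  define j where "j = min i (n + 1 - i)"
  have j: "j \<in> {1..(n + 1) div 2}" using assms by (auto simp: j_def min_def)
  note entry = entry_min[OF assms, folded j_def]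
  have "a_poly n e i = of_int (int (entry e i)) + 2 * (Var j + of_int (1 - int (entry e i)))"
    unfolding a_poly_def j_def[symmetric] Let_def using entry by (auto simp: algebra_simps)
  moreover have "Var j + of_int (1 - int (entry e i)) \<in> int_polys_in {1..(n + 1) div 2}"
    using j by (intro int_polys_in_intros)
  ultimately show ?thesis by blast
qed

lemma rec_poly_mod_2:
  assumes "permissible n e" "m \<le> n"
  shows "\<exists>h\<in>int_polys_in {1..(n + 1) div 2}.
      P_poly n e m = of_int (P_rec (\<lambda>i. int (entry e i)) m) + 2 * h"
    "\<exists>h\<in>int_polys_in {1..(n + 1) div 2}.
      Q_poly n e m = of_int (Q_rec (\<lambda>i. int (entry e i)) m) + 2 * h"
proof -
  define S where "S = int_polys_in {1..(n + 1) div 2}"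
  \<comment> \<open>Congruence modulo 2 between an integer polynomial and an integer. It respects
    sums and products, so \<open>rec_related\<close> lifts it from the partial quotients to
    \<open>P_poly\<close> and \<open>Q_poly\<close>.\<close>
  define R where "R x y \<longleftrightarrow> (\<exists>h\<in>S. x = of_int y + 2 * h)" for x and y :: int
  note S = int_polys_in_intros[where V = "{1..(n + 1) div 2}", folded S_def]
  have add: "R (x + x') (y + y')" if xy: "R x y" "R x' y'" for x x' y y'
  proof -
    from xy obtain h h' where "h \<in> S" "h' \<in> S" "x = of_int y + 2 * h" "x' = of_int y' + 2 * h'"
      by (auto simp: R_def)
    then show ?thesis unfolding R_def
      by (intro bexI[of _ "h + h'"]) (auto intro!: S simp: algebra_simps)
  qed
  have mult: "R (x * x') (y * y')" if xy: "R x y" "R x' y'" for x x' y y'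
  proof -
    from xy obtain h h' where "h \<in> S" "h' \<in> S" "x = of_int y + 2 * h" "x' = of_int y' + 2 * h'"
      by (auto simp: R_def)
    then show ?thesis unfolding R_def
      by (intro bexI[of _ "of_int y * h' + h * of_int y' + 2 * h * h'"])
        (auto intro!: S simp: algebra_simps)
  qed
  have "R 0 0" "R 1 1" unfolding R_def by (auto intro!: bexI[of _ 0] S)
  moreover have "R (a_poly n e i) (int (entry e i))" if "1 \<le> i" "i \<le> n" for i
    unfolding R_def S_def using assms(1) that by (rule a_poly_mod_2)
  ultimately have "R (P_rec (a_poly n e) m) (P_rec (\<lambda>i. int (entry e i)) m)"
    "R (Q_rec (a_poly n e) m) (Q_rec (\<lambda>i. int (entry e i)) m)"
    using add mult assms(2) by - (rule rec_related[where R = R and n = n]; blast)+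
  then show "\<exists>h\<in>int_polys_in {1..(n + 1) div 2}.
      P_poly n e m = of_int (P_rec (\<lambda>i. int (entry e i)) m) + 2 * h"
    "\<exists>h\<in>int_polys_in {1..(n + 1) div 2}.
      Q_poly n e m = of_int (Q_rec (\<lambda>i. int (entry e i)) m) + 2 * h"
    by (simp_all add: R_def S_def P_poly_def Q_poly_def)
qed

lemma rec_poly_int_polys:
  assumes "permissible n e" "m \<le> n"
  shows "P_poly n e m \<in> int_polys_in {1..(n + 1) div 2}" "Q_poly n e m \<in> int_polys_in {1..(n + 1) div 2}"
  using rec_poly_mod_2[OF assms] by (auto intro!: int_polys_in_intros)

text \<open>Permissibility enters here: it makes the halved product in \<open>a0_poly\<close> an
  integer polynomial.\<close>

lemma permissible_half_product:
  assumes "n \<ge> 1" "permissible n e"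
  shows "\<exists>W\<in>int_polys_in {1..(n + 1) div 2}. Q_poly n e (n - 1) * P_poly n e (n - 1) = 2 * W"
proof -
  define p where "p = P_rec (\<lambda>i. int (entry e i)) (n - 1)"
  define q where "q = Q_rec (\<lambda>i. int (entry e i)) (n - 1)"
  obtain g where g: "g \<in> int_polys_in {1..(n + 1) div 2}" "P_poly n e (n - 1) = of_int p + 2 * g"
    using rec_poly_mod_2(1)[OF assms(2), of "n - 1"] by (auto simp: p_def)
  obtain h where h: "h \<in> int_polys_in {1..(n + 1) div 2}" "Q_poly n e (n - 1) = of_int q + 2 * h"
    using rec_poly_mod_2(2)[OF assms(2), of "n - 1"] by (auto simp: q_def)
  have "even (q * p)" using assms by (simp add: permissible_iff p_def q_def)
  then obtain w where "q * p = 2 * w" by (elim evenE)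
  then have w: "(of_int q * of_int p :: mpoly) = 2 * of_int w"
    using of_int_mult[of q p] of_int_mult[of 2 w] by (metis of_int_numeral)
  have "Q_poly n e (n - 1) * P_poly n e (n - 1) =
    of_int q * of_int p + 2 * (of_int q * g + h * of_int p + 2 * h * g)"
    unfolding g(2) h(2) by (simp add: algebra_simps)
  also have "\<dots> = 2 * (of_int w + (of_int q * g + h * of_int p + 2 * h * g))"
    unfolding w by (simp add: distrib_left)
  finally show ?thesis
    by (rule bexI) (use g(1) h(1) in \<open>auto intro!: int_polys_in_intros\<close>)
qed

lemma a0_poly_eq:
  assumes "Q_poly n e (n - 1) * P_poly n e (n - 1) = 2 * W"
  shows "a0_poly n e = (-1) ^ n * W + Var 0 * Q_poly n e n"
proof -
  have "Cst ((-1) ^ n / 2) * 2 = (-1) ^ n"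
    using mult_single[of 0 "(-1) ^ n / 2" 0 "2 :: real"]
    by (cases "even n") (simp_all add: Cst_def single_uminus)
  then have "Cst ((-1) ^ n / 2) * (2 * W) = (-1) ^ n * W" by (simp only: mult.assoc[symmetric])
  then show ?thesis unfolding a0_poly_def assms by simp
qed

lemma poly_rec_symmetric:
  assumes "n \<ge> 1"
  shows "P_poly n e n = Q_poly n e (n - 1)"
    "Q_poly n e n * P_poly n e (n - 1) - Q_poly n e (n - 1) * Q_poly n e (n - 1) = (-1) ^ n"
  unfolding P_poly_def Q_poly_def using rec_symmetric[OF assms, of "a_poly n e"] a_poly_symmetric
  by blast+

lemma neg_one_power_square: "(-1) ^ n * (-1) ^ n = (1 :: 'a::comm_ring_1)"
  by (simp flip: power_mult_distrib)

lemma F_poly_equations: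
  assumes "n \<ge> 1" "permissible n e"
  shows "Q_poly n e n * (F_poly n e - (a0_poly n e)\<^sup>2) =
      2 * Q_poly n e (n - 1) * a0_poly n e + P_poly n e (n - 1)"
    "(C_poly n e)\<^sup>2 - F_poly n e * (H_poly n e)\<^sup>2 = - ((-1) ^ n)"
proof -
  obtain W where W: "Q_poly n e (n - 1) * P_poly n e (n - 1) = 2 * W"
    using permissible_half_product[OF assms] by blast
  note F_poly_identity[OF poly_rec_symmetric(2)[OF assms(1)] neg_one_power_square W a0_poly_eq[OF W]]
  then show "Q_poly n e n * (F_poly n e - (a0_poly n e)\<^sup>2) =
      2 * Q_poly n e (n - 1) * a0_poly n e + P_poly n e (n - 1)"
    "(C_poly n e)\<^sup>2 - F_poly n e * (H_poly n e)\<^sup>2 = - ((-1) ^ n)"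
    unfolding F_poly_def C_poly_def H_poly_def poly_rec_symmetric(1)[OF assms(1)] by blast+
qed

lemma poly_int_polys:
  assumes "n \<ge> 1" "permissible n e"
  defines "S \<equiv> int_polys ((n + 1) div 2)"
  shows "F_poly n e \<in> S" "C_poly n e \<in> S" "H_poly n e \<in> S"
proof -
  have sub: "int_polys_in {1..(n + 1) div 2} \<subseteq> S"
    unfolding S_def int_polys_eq by (rule int_polys_in_mono) auto
  obtain W where W: "W \<in> S" "Q_poly n e (n - 1) * P_poly n e (n - 1) = 2 * W"
    using permissible_half_product[OF assms(1,2)] sub by blast
  have PQ: "P_poly n e m \<in> S" "Q_poly n e m \<in> S" if "m \<le> n" for m
    using rec_poly_int_polys[OF assms(2) that] sub by blast+
  note intros = int_polys_in_intros[where V = "{0..(n + 1) div 2}", folded int_polys_eq, folded S_def]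
  have "a0_poly n e \<in> S" unfolding a0_poly_eq[OF W(2)] using W(1) by (auto intro!: intros PQ)
  then show "F_poly n e \<in> S" "C_poly n e \<in> S" "H_poly n e \<in> S"
    unfolding F_poly_def C_poly_def H_poly_def by (auto intro!: intros PQ)
qed

section \<open>Values at admissible tuples\<close>

lemma eval_a_poly:
  assumes "permissible n e" "1 \<le> i" "i \<le> n"
  shows "eval_at t (a_poly n e i) = 2 * t (min i (n + 1 - i)) + (if entry e i = 1 then 1 else 2)"
  using entry_min(1)[OF assms] by (simp add: a_poly_def Let_def)

lemma eval_rec_matrix:
  fixes n e t
  defines "bs \<equiv> map (\<lambda>i. eval_at t (a_poly n e i)) [1..<n + 1]"
  assumes "n \<ge> 1"
  shows "cf_matrix bs $ 1 $ 1 = eval_at t (Q_poly n e n)"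
    "cf_matrix bs $ 2 $ 1 = eval_at t (Q_poly n e (n - 1))"
    "cf_matrix bs $ 1 $ 2 = eval_at t (Q_poly n e (n - 1))"
    "cf_matrix bs $ 2 $ 2 = eval_at t (P_poly n e (n - 1))"
  unfolding bs_def poly_rec_symmetric(1)[OF assms(2), symmetric] eval_at_P_poly
  using cf_matrix_rec(1,2)[of "\<lambda>i. eval_at t (a_poly n e i)" n]
    cf_matrix_rec(3,4)[OF assms(2), of "\<lambda>i. eval_at t (a_poly n e i)"]
    arg_cong[OF poly_rec_symmetric(1)[OF assms(2)], of "eval_at t" e]
  by (simp_all only: eval_at_P_poly eval_at_Q_poly)

lemma eval_F_equation:
  assumes "n \<ge> 1" "permissible n e"
  shows "eval_at t (Q_poly n e n) * (eval_at t (F_poly n e) - (eval_at t (a0_poly n e))\<^sup>2) =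
    2 * eval_at t (Q_poly n e (n - 1)) * eval_at t (a0_poly n e) + eval_at t (P_poly n e (n - 1))"
  using arg_cong[OF F_poly_equations(1)[OF assms], of "eval_at t"] by simp

lemma admissible_quotients:
  assumes "permissible n e" "admissible n e t"
  shows "\<forall>a\<in>set (map (\<lambda>i. eval_at t (a_poly n e i)) [1..<n + 1]). a \<in> \<int> \<and> a \<ge> 1"
proof -
  have "eval_at t (a_poly n e i) \<in> \<int> \<and> eval_at t (a_poly n e i) \<ge> 1" if i: "1 \<le> i" "i \<le> n" for i
  proof -
    have "min i (n + 1 - i) \<in> {1..(n + 1) div 2}" using i by (auto simp: min_def)
    then have "t (min i (n + 1 - i)) \<in> \<nat>" using assms(2) unfolding admissible_def by blast
    then show ?thesis unfolding eval_a_poly[OF assms(1) i] by (auto elim!: Nats_cases)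
  qed
  then show ?thesis by (auto simp del: upt_Suc)
qed

lemma expansion_seq_eq:
  "expansion_seq n e t = periodic_seq (eval_at t (a0_poly n e))
    (map (\<lambda>i. eval_at t (a_poly n e i)) [1..<n + 1] @ [2 * eval_at t (a0_poly n e)])"
  by (simp add: expansion_seq_def)

lemma cf_matrix_pos:
  assumes "\<forall>a\<in>set xs. a > (0 :: real)"
  shows "cf_matrix xs $ 1 $ 1 > 0"
  using assms
proof (induction xs)
  case (Cons x xs)
  have "cf_matrix xs $ 2 $ 1 \<ge> 0" using Cons.prems by (intro cf_matrix_nonneg) auto
  with Cons show ?case by (simp add: add_pos_nonneg)
qed simp

lemma admissible_expansion:
  assumes "n \<ge> 1" "permissible n e" "admissible n e t"
  shows "eval_at t (a0_poly n e) \<in> \<int>" "eval_at t (a0_poly n e) > 0"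
    "eval_at t (F_poly n e) \<in> \<int>" "simple_cf (expansion_seq n e t) (sqrt (eval_at t (F_poly n e)))"
proof -
  define bs where "bs = map (\<lambda>i. eval_at t (a_poly n e i)) [1..<n + 1]"
  define b0 where "b0 = eval_at t (a0_poly n e)"
  define D where "D = eval_at t (F_poly n e)"
  define Q where "Q = eval_at t (Q_poly n e n)"
  define Q' where "Q' = eval_at t (Q_poly n e (n - 1))"
  define P' where "P' = eval_at t (P_poly n e (n - 1))"
  have bs: "\<forall>a\<in>set bs. a \<in> \<int> \<and> a \<ge> 1"
    unfolding bs_def by (rule admissible_quotients[OF assms(2,3)])
  then have bs_pos: "\<forall>a\<in>set bs. a > 0" by auto
  note M = eval_rec_matrix[OF assms(1), of t e, folded bs_def Q_def Q'_def P'_def]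
  have Q: "Q > 0" using cf_matrix_pos[OF bs_pos] by (simp add: M)
  have nonneg: "Q' \<ge> 0" "P' \<ge> 0"
    using cf_matrix_nonneg[of bs 2] bs_pos unfolding M(2,4)[symmetric] by (simp_all add: less_imp_le)
  have int: "Q' \<in> \<int>" "P' \<in> \<int>"
    using cf_matrix_Ints[of bs] bs unfolding M(2,4)[symmetric] by blast+
  obtain W where W: "W \<in> int_polys_in {1..(n + 1) div 2}"
    "Q_poly n e (n - 1) * P_poly n e (n - 1) = 2 * W"
    using permissible_half_product[OF assms(1,2)] by blast
  have QW: "Q' * P' = 2 * eval_at t W"
    using arg_cong[OF W(2), of "eval_at t"] by (simp add: Q'_def P'_def)
  \<comment> \<open>\<open>W\<close> does not involve the variable 0, so integrality of the other
    entries of the tuple suffices.\<close>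
  have "eval_at t W \<in> \<int>"
    using W(1) by (rule eval_at_Ints)
      (use assms(3) Nats_subset_Ints in \<open>unfold admissible_def; blast\<close>)
  moreover have b0_eq: "b0 = (-1) ^ n * eval_at t W + t 0 * Q"
    unfolding b0_def a0_poly_eq[OF W(2)] by (simp add: Q_def)
  moreover have "t 0 * Q \<in> \<int>" using assms(3) by (simp add: admissible_def Q_def)
  ultimately have b0_int: "b0 \<in> \<int>" by auto
  \<comment> \<open>After multiplication by \<open>Q\<close>, the lower bound on \<open>t 0\<close>
    says exactly that \<open>b0\<close> is positive.\<close>
  have "t 0 > (-1) ^ (n + 1) * (Q' * P') / (2 * Q)"
    using assms(3) by (simp add: admissible_def Q_def Q'_def P'_def)
  then have "(-1) ^ (n + 1) * eval_at t W / Q < t 0" unfolding QW by simp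
  then have "t 0 * Q > (-1) ^ (n + 1) * eval_at t W" using Q by (simp only: pos_divide_less_eq)
  then have b0_pos: "b0 > 0" by (simp add: b0_eq)
  have eq: "Q * (D - b0\<^sup>2) = 2 * Q' * b0 + P'"
    using eval_F_equation[OF assms(1,2), of t] by (simp add: Q_def Q'_def P'_def D_def b0_def)
  then have "Q * (D - b0\<^sup>2) \<ge> 0" using nonneg b0_pos by simp
  then have "D \<ge> b0\<^sup>2" using Q by (simp add: zero_le_mult_iff)
  then have D: "D > 0" using b0_pos by (smt (verit) zero_less_power)
  \<comment> \<open>Apart from the integer \<open>b0\<close>, only \<open>2 * t 0\<close> occurs, so
    a half-integral \<open>t 0\<close> does no harm.\<close>
  have "D = b0\<^sup>2 + 2 * t 0 * Q' + (-1) ^ n * P'\<^sup>2"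
    by (simp add: D_def F_poly_def b0_def Q'_def P'_def poly_rec_symmetric(1)[OF assms(1)])
  moreover have "2 * t 0 \<in> \<int>" using assms(3) by (simp add: admissible_def)
  ultimately have D_int: "D \<in> \<int>"
    using b0_int int by (simp add: Ints_add Ints_mult Ints_power)
  have "sqrt D = b0 + 1 / cf_value bs (sqrt D + b0)"
    using D b0_pos eq
    by (subst periodic_cf_equation[OF bs_pos]) (simp_all add: M add_pos_pos algebra_simps)
  then have "simple_cf (periodic_seq b0 (bs @ [2 * b0])) (sqrt D)"
    by (rule simple_cf_periodic_seq[OF b0_int b0_pos bs, rotated]) (use D in simp)
  with b0_int b0_pos D_int show "eval_at t (a0_poly n e) \<in> \<int>" "eval_at t (a0_poly n e) > 0"
    "eval_at t (F_poly n e) \<in> \<int>" "simple_cf (expansion_seq n e t) (sqrt (eval_at t (F_poly n e)))"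
    by (simp_all add: b0_def D_def bs_def expansion_seq_eq)
qed

lemma admissible_fundamental:
  assumes "n \<ge> 1" "permissible n e" "admissible n e t"
    "no_shorter_period_same_parity (expansion_seq n e t) (n + 1)"
  shows "fundamental_solution (eval_at t (F_poly n e)) ((-1) ^ (n + 1))
    (eval_at t (C_poly n e)) (eval_at t (H_poly n e))"
proof -
  obtain D :: int where D: "eval_at t (F_poly n e) = D"
    using admissible_expansion(3)[OF assms(1-3)] by (auto elim: Ints_cases)
  note fundamental_solution_periodic[OF admissible_quotients[OF assms(2,3)]
      admissible_expansion(1,2)[OF assms(1-3)], of D]
  then show ?thesis
    using admissible_expansion(4)[OF assms(1-3)] assms(4) eval_rec_matrix[OF assms(1), of t e]
    unfolding expansion_seq_eq[symmetric] D C_poly_def H_poly_def poly_rec_symmetric(1)[OF assms(1)]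
    by (simp del: upt_Suc)
qed

text \<open>Equal values have the same expansion by \<open>simple_cf_unique\<close>, hence the same
  partial quotients, whose parities are the entries of the sequence.\<close>

lemma admissible_unique:
  assumes "n \<ge> 1" "permissible n e" "admissible n e t" "permissible n e'" "admissible n e' t'"
    and F: "eval_at t (F_poly n e) = eval_at t' (F_poly n e')"
  shows "e = e'"
proof -
  have expansion: "expansion_seq n e t = expansion_seq n e' t'"
    using admissible_expansion(4)[OF assms(1-3)] admissible_expansion(4)[OF assms(1,4,5)] F
    by (auto intro: simple_cf_unique)
  have len: "length e = n" "length e' = n" using assms(2,4) by (auto simp: permissible_def)
  show ?thesis
  proof (rule nth_equalityI)
    show "length e = length e'" by (simp add: len)
    fix l assume "l < length e"
    define i where "i = Suc l"
    have i: "1 \<le> i" "i \<le> n" using \<open>l < length e\<close> len by (auto simp: i_def)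
    define j where "j = min i (n + 1 - i)"
    have j: "j \<in> {1..(n + 1) div 2}" using i by (auto simp: j_def min_def)
    have seq: "expansion_seq n e t i = eval_at t (a_poly n e i)" for e t
      using i by (cases i) (simp_all add: expansion_seq_def periodic_seq_def nth_append del: upt_Suc)
    have "t j \<in> \<nat>" "t' j \<in> \<nat>" using assms(3,5) j unfolding admissible_def by blast+
    then obtain u u' where u: "t j = real u" "t' j = real u'" by (auto elim!: Nats_cases)
    have "eval_at t (a_poly n e i) = eval_at t' (a_poly n e' i)"
      using expansion seq by metis
    then have h: "2 * real u + (if entry e i = 1 then 1 else 2) =
      2 * real u' + (if entry e' i = 1 then 1 else 2)"
      unfolding eval_a_poly[OF assms(2) i] eval_a_poly[OF assms(4) i] j_def[symmetric] u .
    have parity: False if "2 * real x + 1 = 2 * real y + 2" for x y :: nat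
    proof -
      have "real (2 * x + 1) = real (2 * y + 2)" using that by simp
      then have "2 * x + 1 = 2 * y + 2" by (simp only: of_nat_eq_iff)
      then show False by presburger
    qed
    have "(entry e i = 1) = (entry e' i = 1)"
      using h parity[of u u'] parity[of u' u] by (auto split: if_splits)
    then have "entry e i = entry e' i"
      using entry_min(2)[OF assms(2) i] entry_min(2)[OF assms(4) i] by auto
    then show "e ! l = e' ! l" by (simp add: entry_def i_def)
  qed
qed

text \<open>If \<open>t\<^sub>0\<close> is a large integer, the tuple is admissible for both sequences.\<close>

lemma F_poly_inj:
  assumes "n \<ge> 1"
  shows "inj_on (F_poly n) {e. permissible n e}"
proof (rule inj_onI)
  fix e e' assume "e \<in> {e. permissible n e}" "e' \<in> {e. permissible n e}" and F: "F_poly n e = F_poly n e'"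
  then have e: "permissible n e" "permissible n e'" by auto
  \<comment> \<open>The lower bound on \<open>t 0\<close> in \<open>admissible\<close> when the
    other entries are 0. It does not depend on \<open>t 0\<close>, because \<open>P_poly\<close> and
    \<open>Q_poly\<close> do not involve that variable.\<close>
  define B where "B e = (-1) ^ (n + 1) *
    (eval_at (\<lambda>_. 0) (Q_poly n e (n - 1)) * eval_at (\<lambda>_. 0) (P_poly n e (n - 1)))
    / (2 * eval_at (\<lambda>_. 0) (Q_poly n e n))" for e
  obtain N :: nat where N: "max (B e) (B e') < N" using reals_Archimedean2 by blast
  define t where "t i = (if i = 0 then real N else 0)" for i :: nat
  have "admissible n f t" if f: "permissible n f" "B f < N" for f
  proof -
    have "eval_at t (a_poly n f i) = eval_at (\<lambda>_. 0) (a_poly n f i)" if "1 \<le> i" "i \<le> n" for i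
      using that by (simp add: eval_a_poly[OF f(1)] t_def)
    then have PQ: "eval_at t (P_poly n f m) = eval_at (\<lambda>_. 0) (P_poly n f m)"
      "eval_at t (Q_poly n f m) = eval_at (\<lambda>_. 0) (Q_poly n f m)" if "m \<le> n" for m
      unfolding eval_at_P_poly eval_at_Q_poly using that
      by - (rule rec_related[where R = "(=)" and n = n]; simp)+
    have "eval_at t (Q_poly n f n) \<in> \<int>"
      using rec_poly_int_polys(2)[OF f(1) order_refl] by (rule eval_at_Ints) (simp add: t_def)
    then show ?thesis
      using f(2) PQ[of n] PQ[of "n - 1"] by (auto simp: admissible_def t_def B_def)
  qed
  then show "e = e'" using admissible_unique[OF assms e(1) _ e(2), of t t] e N F by simp
qed

text \<open>With \<open>b0\<close> for \<open>b\<close> and \<open>D - b0\<^sup>2\<close> for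
  \<open>K\<close>, the cofactor of \<open>Q\<close> is \<open>2 * t 0\<close> for the
  \<open>t 0\<close> determined by \<open>b0\<close>, which is thereby seen to be integral.\<close>

lemma partial_quotient_divisibility:
  fixes Q Q' P' K b s :: "'a::comm_ring_1"
  assumes "Q * P' - Q' * Q' = s" "s * s = 1" "Q * K = 2 * Q' * b + P'"
  shows "2 * b - s * (Q' * P') = Q * (s * (2 * b * P' - Q' * K))"
proof -
  have "Q * (s * (2 * b * P' - Q' * K)) = s * (2 * b * (Q * P') - Q' * (Q * K))"
    by (simp add: algebra_simps)
  also have "\<dots> = s * (2 * b * (Q * P' - Q' * Q') - Q' * P')"
    unfolding assms(3) by (simp add: algebra_simps)
  also have "\<dots> = (s * s) * (2 * b) - s * (Q' * P')"
    unfolding assms(1) by (simp add: algebra_simps)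
  finally show ?thesis by (simp add: assms(2))
qed

lemma sqrt_period_admissible:
  assumes "n \<ge> 1" "sqrt_has_period D n"
  shows "\<exists>e t. permissible n e \<and> admissible n e t \<and> real D = eval_at t (F_poly n e)"
proof -
  obtain b0 bs where len: "length bs = n"
    and cf: "simple_cf (periodic_seq b0 (bs @ [2 * b0])) (sqrt D)"
    using assms(2) by (auto simp: sqrt_has_period_def)
  define c where "c = periodic_seq b0 (bs @ [2 * b0])"
  have c: "c 0 = b0" "c (Suc n) = 2 * b0" "\<And>i. i < n \<Longrightarrow> c (Suc i) = bs ! i"
    using len by (auto simp: c_def periodic_seq_def nth_append)
  have c_int: "c i \<in> \<int>" for i using cf by (simp add: simple_cf_def c_def)
  have c_ge: "c i \<ge> 1" if "i \<ge> 1" for i using simple_cf_ge_1[OF cf that] by (simp add: c_def)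
  \<comment> \<open>Positivity of \<open>b0\<close> is read off from the later partial quotient
    \<open>2 * b0\<close>, as \<open>simple_cf\<close> puts no sign condition on the zeroth
    one.\<close>
  have b0: "b0 \<in> \<int>" "b0 > 0" using c_int[of 0] c_ge[of "Suc n"] by (auto simp: c)
  have bs: "\<forall>a\<in>set bs. a \<in> \<int> \<and> a \<ge> 1"
    using c_int c_ge c(3) len by (metis One_nat_def Suc_le_mono in_set_conv_nth le0)
  define d where "d i = nat \<lfloor>bs ! (i - 1)\<rfloor>" for i
  have d: "bs ! (i - 1) = real (d i)" "d i \<ge> 1" if "1 \<le> i" "i \<le> n" for i
  proof -
    have "bs ! (i - 1) \<in> set bs" using that len by simp
    then have "bs ! (i - 1) \<in> \<int>" "bs ! (i - 1) \<ge> 1" using bs by auto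
    then show "bs ! (i - 1) = real (d i)" "d i \<ge> 1" by (auto simp: d_def elim!: Ints_cases)
  qed
  have eq: "sqrt D = b0 + 1 / cf_value bs (sqrt D + b0)"
    by (rule cf_value_of_simple_cf_periodic[OF cf])
  have sqrt_b0: "sqrt D + b0 > 0" using b0 by (simp add: add_nonneg_pos)
  have "(sqrt D)\<^sup>2 \<in> \<int>" by simp
  note sym = periodic_cf_symmetric[OF bs b0(1) this simple_cf_irrational[OF cf] sqrt_b0 eq]
  have d_sym: "d (n + 1 - i) = d i" if "1 \<le> i" "i \<le> n" for i
  proof -
    have "bs ! (i - 1) = rev bs ! (i - 1)" by (simp only: sym(3))
    also have "\<dots> = bs ! (n + 1 - i - 1)" using that len by (simp add: rev_nth)
    finally show ?thesis by (simp add: d_def)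
  qed
  define e where "e = map (\<lambda>i. d i mod 2) [1..<n + 1]"
  have entry: "entry e i = d i mod 2" if "1 \<le> i" "i \<le> n" for i
    using that by (cases i) (simp_all add: e_def entry_def del: upt_Suc)
  define Qi where "Qi = Q_rec (\<lambda>i. int (d i)) n"
  define Qi' where "Qi' = Q_rec (\<lambda>i. int (d i)) (n - 1)"
  define Pi' where "Pi' = P_rec (\<lambda>i. int (d i)) (n - 1)"
  obtain a where a: "b0 = real_of_int a" using b0 by (auto elim: Ints_cases)
  define K where "K = int D - a\<^sup>2"
  have "bs = map real_of_int (map (\<lambda>i. int (d i)) [1..<n + 1])"
  proof (intro nth_equalityI)
    fix l assume "l < length bs"
    then show "bs ! l = map real_of_int (map (\<lambda>i. int (d i)) [1..<n + 1]) ! l"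
      using len d(1)[of "Suc l"] by (simp del: upt_Suc)
  qed (simp add: len)
  then have "cf_matrix bs $ i $ j = real_of_int (cf_matrix (map (\<lambda>i. int (d i)) [1..<n + 1]) $ i $ j)" for i j
    by (simp only: cf_matrix_of_int)
  note M = this[of 1 1] this[of 2 1] this[of 1 2] this[of 2 2]
  have Pn: "P_rec (\<lambda>i. int (d i)) n = Qi'"
    and det: "Qi * Pi' - Qi' * Qi' = (-1) ^ n"
    using rec_symmetric[OF assms(1), of "\<lambda>i. int (d i)"] d_sym by (auto simp: Qi_def Qi'_def Pi'_def)
  note M = M[unfolded cf_matrix_rec(1,2) cf_matrix_rec(3,4)[OF assms(1)] Pn,
      folded Qi_def Qi'_def Pi'_def]
  have "real_of_int (Qi * K) = real_of_int (2 * Qi' * a + Pi')"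
    using sym(2) by (simp add: M a K_def)
  then have QK: "Qi * K = 2 * Qi' * a + Pi'" by (simp only: of_int_eq_iff)
  \<comment> \<open>If \<open>Qi'\<close> and \<open>Pi'\<close> were odd, \<open>QK\<close> would
    make \<open>Qi\<close> odd as well, and the determinant \<open>Qi * Pi' - Qi' * Qi'\<close>
    would be even instead of \<plusminus>1.\<close>
  have even: "even (Qi' * Pi')"
  proof (rule ccontr)
    assume odd: "odd (Qi' * Pi')"
    then have "odd (Qi * K)" by (simp add: QK)
    then have "even (Qi * Pi' - Qi' * Qi')" using odd by simp
    then show False unfolding det by simp
  qed
  have "even (Q_rec (\<lambda>i. int (entry e i)) (n - 1)) = even Qi'"
    "even (P_rec (\<lambda>i. int (entry e i)) (n - 1)) = even Pi'"
    unfolding Qi'_def Pi'_def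
    by (rule rec_related[where R = "\<lambda>x y. even (x :: int) = even (y :: int)" and n = n]; simp add: entry)+
  then have perm: "permissible n e"
    using even d_sym entry unfolding permissible_iff[OF assms(1)]
    by (auto simp: symmetric_seq_def e_def simp del: upt_Suc)
  define s :: real where "s = (-1) ^ n"
  have ss: "s * s = 1" by (simp add: s_def flip: power_mult_distrib)
  \<comment> \<open>\<open>t 0\<close> is obtained by solving \<open>a\<^sub>0 = b0\<close>; a
    partial quotient \<open>2 * u + 1\<close> or \<open>2 * u + 2\<close> comes from
    \<open>u = (d i - 1) div 2\<close>.\<close>
  define t where "t i = (if i = 0 then (b0 - s * (real_of_int (Qi' * Pi')) / 2) / real_of_int Qi
    else real ((d i - 1) div 2))" for i
  have eval_a: "eval_at t (a_poly n e i) = real (d i)" if i: "1 \<le> i" "i \<le> n" for i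
  proof -
    define j where "j = min i (n + 1 - i)"
    have j: "1 \<le> j" "j \<le> n" "d j = d i" using i d_sym[OF i] by (auto simp: j_def min_def)
    have "2 * ((d i - 1) div 2) + (if d i mod 2 = 1 then 1 else 2) = d i"
      using d(2)[OF i] by (auto; presburger)
    then have "real (2 * ((d i - 1) div 2) + (if d i mod 2 = 1 then 1 else 2)) = real (d i)"
      by (simp only:)
    moreover have "t j = real ((d i - 1) div 2)" using j by (simp add: t_def)
    ultimately show ?thesis
      unfolding eval_a_poly[OF perm i] j_def[symmetric] entry[OF i] by (auto split: if_splits)
  qed
  have eval_bs: "map (\<lambda>i. eval_at t (a_poly n e i)) [1..<n + 1] = bs"
  proof (intro nth_equalityI)
    fix l assume "l < length (map (\<lambda>i. eval_at t (a_poly n e i)) [1..<n + 1])"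
    then show "map (\<lambda>i. eval_at t (a_poly n e i)) [1..<n + 1] ! l = bs ! l"
      using len d(1)[of "Suc l"] eval_a[of "Suc l"] by (simp del: upt_Suc)
  qed (simp add: len)
  note E = eval_rec_matrix[OF assms(1), of t e, unfolded eval_bs M, symmetric]
  have Q: "real_of_int Qi > 0"
    unfolding M(1)[symmetric] by (rule cf_matrix_pos) (use bs in fastforce)
  have "2 * b0 - s * (real_of_int (Qi' * Pi')) = real_of_int Qi * (s * (2 * b0 * Pi' - Qi' * K))"
  proof -
    have "real_of_int (Qi * Pi' - Qi' * Qi') = s" unfolding det s_def by simp
    moreover have "real_of_int Qi * K = 2 * Qi' * b0 + Pi'"
      using arg_cong[OF QK, of real_of_int] by (simp add: a)
    ultimately show ?thesis
      using partial_quotient_divisibility[of Qi Pi' Qi' s K b0] ss by simp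
  qed
  then have "2 * t 0 = s * (2 * b0 * Pi' - Qi' * K)" using Q by (simp add: t_def field_simps)
  also have "\<dots> \<in> \<int>" by (simp add: s_def a)
  finally have t0: "2 * t 0 \<in> \<int>" .
  have t0Q: "t 0 * Qi = b0 - s * (real_of_int (Qi' * Pi') / 2)" using Q by (simp add: t_def)
  obtain w where w: "Qi' * Pi' = 2 * w" using even by (elim evenE)
  have "t 0 * Qi \<in> \<int>" unfolding t0Q w by (simp add: s_def a)
  moreover have "t 0 > (-1) ^ (n + 1) * (real_of_int Qi' * real_of_int Pi') / (2 * real_of_int Qi)"
  proof -
    have "t 0 - (-1) ^ (n + 1) * (real_of_int Qi' * real_of_int Pi') / (2 * real_of_int Qi) = b0 / Qi"
      using Q by (simp add: t_def s_def field_simps)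
    also have "\<dots> > 0" using b0 Q by simp
    finally show ?thesis by simp
  qed
  moreover have "\<forall>i\<in>{1..(n + 1) div 2}. t i \<in> \<nat>" by (simp add: t_def)
  ultimately have adm: "admissible n e t"
    unfolding admissible_def E using t0 by blast
  have "eval_at t (a0_poly n e) = s / 2 * (real_of_int Qi' * real_of_int Pi') + t 0 * Qi"
    by (simp only: a0_poly_def eval_at_add eval_at_mult eval_at_Cst eval_at_Var E s_def)
  then have a0: "eval_at t (a0_poly n e) = b0" unfolding t0Q by simp
  \<comment> \<open>The value of \<open>F_poly\<close> and \<open>D\<close> satisfy the same linear
    equation with leading coefficient \<open>Qi > 0\<close>.\<close>
  have "real_of_int Qi * (eval_at t (F_poly n e) - b0\<^sup>2) = 2 * Qi' * b0 + Pi'"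
    using eval_F_equation[OF assms(1) perm, of t] unfolding E a0 by simp
  also have "\<dots> = real_of_int Qi * (D - b0\<^sup>2)"
    using arg_cong[OF QK, of real_of_int] by (simp add: K_def a)
  finally have "real_of_int Qi * (eval_at t (F_poly n e) - b0\<^sup>2) = real_of_int Qi * (D - b0\<^sup>2)" .
  then have "eval_at t (F_poly n e) = D" using Q by simp
  with perm adm show ?thesis by metis
qed

theorem theorem2:
  fixes n :: nat
  assumes "n \<ge> 1"
  shows
    "(card (F_poly n ` {e. permissible n e}) = r n \<and>
      (\<forall>e. permissible n e \<longrightarrow> fermat_pell_poly ((n + 1) div 2) (F_poly n e)) \<and>
      (\<forall>D::nat. D > 0 \<and> sqrt_has_period D n \<longrightarrow>
         (\<exists>!e. permissible n e \<and>
            (\<exists>t. admissible n e t \<and> real D = eval_at t (F_poly n e))))) \<and>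
     (\<forall>e t. permissible n e \<and> admissible n e t \<longrightarrow>
        eval_at t (a0_poly n e) \<in> \<int> \<and> eval_at t (a0_poly n e) > 0 \<and>
        simple_cf (expansion_seq n e t) (sqrt (eval_at t (F_poly n e)))) \<and>
     (\<forall>e. permissible n e \<longrightarrow>
        C_poly n e \<in> int_polys ((n + 1) div 2) \<and> H_poly n e \<in> int_polys ((n + 1) div 2) \<and>
        (C_poly n e)\<^sup>2 - F_poly n e * (H_poly n e)\<^sup>2 = (-1) ^ (n - 1) \<and>
        (\<forall>t. admissible n e t \<and> no_shorter_period_same_parity (expansion_seq n e t) (n + 1) \<longrightarrow>
           fundamental_solution (eval_at t (F_poly n e)) ((-1) ^ (n - 1))
             (eval_at t (C_poly n e)) (eval_at t (H_poly n e))))"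
proof -
  \<comment> \<open>Subtraction is truncated, so both rewritings rely on
    \<open>n \<ge> 1\<close>.\<close>
  have sign: "(-1) ^ (n - 1) = (- ((-1) ^ n) :: mpoly)" "(-1) ^ (n - 1) = ((-1) ^ (n + 1) :: real)"
    using assms by (cases n; simp)+
  have pell: "fermat_pell_poly ((n + 1) div 2) (F_poly n e)" if "permissible n e" for e
  proof -
    have "- ((-1) ^ n) = (1 :: mpoly) \<or> - ((-1) ^ n) = (-1 :: mpoly)" by (cases "even n") simp_all
    then show ?thesis
      unfolding fermat_pell_poly_def F_poly_equations(2)[OF assms that, symmetric]
      using poly_int_polys[OF assms that] by blast
  qed
  have unique: "\<exists>!e. permissible n e \<and> (\<exists>t. admissible n e t \<and> real D = eval_at t (F_poly n e))"
    if period: "sqrt_has_period D n" for D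
  proof (rule ex_ex1I)
    show "\<exists>e. permissible n e \<and> (\<exists>t. admissible n e t \<and> real D = eval_at t (F_poly n e))"
      using sqrt_period_admissible[OF assms period] by blast
  next
    fix e e'
    assume "permissible n e \<and> (\<exists>t. admissible n e t \<and> real D = eval_at t (F_poly n e))"
      "permissible n e' \<and> (\<exists>t. admissible n e' t \<and> real D = eval_at t (F_poly n e'))"
    then obtain t t' where "permissible n e" "admissible n e t" "permissible n e'" "admissible n e' t'"
      "eval_at t (F_poly n e) = eval_at t' (F_poly n e')" by auto
    then show "e = e'" by (rule admissible_unique[OF assms])
  qed
  show ?thesis
    unfolding sign r_def card_image[OF F_poly_inj[OF assms]]
    by (intro conjI allI impI; (elim conjE)?;
      (rule refl pell unique poly_int_polys(2,3)[OF assms] F_poly_equations(2)[OF assms]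
        admissible_expansion(1,2,4)[OF assms] admissible_fundamental[OF assms]; assumption))
qed

end
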